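(* Suppose $\boldsymbol{A}\in \mathbb{DQ}^{m \times n}$, $\boldsymbol{B}\in \mathbb{DQ}^{m \times l}$, $\mathrm{rank}(\boldsymbol{A})=p$, $\mathrm{rank}(\boldsymbol{B})=q$. There exist a unitary matrix $\boldsymbol{Q}\in \mathbb{DQ}^{m \times m}$ and dual quaternion matrices $\boldsymbol{X}_{\boldsymbol{A}}\in \mathbb{DQ}^{n \times n}$, $\boldsymbol{X}_{\boldsymbol{B}}\in \mathbb{DQ}^{l \times l}$ such that $$\boldsymbol{A}=\boldsymbol{Q}(\Sigma_{\boldsymbol{A}},\ 0)\boldsymbol{X}_{\boldsymbol{A}},\qquad \boldsymbol{B}=\boldsymbol{Q}(\Sigma_{\boldsymbol{B}},\ 0)\boldsymbol{X}_{\boldsymbol{B}},$$ where $\Sigma_{\boldsymbol{A}}$ is $m\times p$ and $\Sigma_{\boldsymbol{B}}$ is $m\times q$, given by $$\Sigma_{\boldsymbol{A}}=\left(\begin{array}{ccccc} I&0&0&0&0\\ 0&I&0&0&0\\ 0&0&C&0&0\\ 0&0&0&D\epsilon&0\\ 0&0&0&0&0\\ \hline \Sigma\epsilon&0&0&0&0\\ 0&0&0&0&0\\ 0&0&S&0&0\\ 0&0&0&I&0\\ 0&0&0&0&I\end{array}\right),\qquad \Sigma_{\boldsymbol{B}}=\left(\begin{array}{c} I_q\\ \hline 0\end{array}\right),$$ with the horizontal lines separating the first $q$ rows from the last $m-q$ rows. Here $\Sigma=\mathrm{diag}(\sigma_1,\dots,\sigma_r)$ is real with $\sigma_1\ge\cdots\ge\sigma_r>0$;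 $D$ is a real diagonal matrix with positive diagonal elements; $C=\mathrm{diag}(c_{i+1},\dots,c_{i+j})$ and $S=\mathrm{diag}(s_{i+1},\dots,s_{i+j})$ have appreciable dual number diagonal entries with $1>c_{i+1}\ge\cdots\ge c_{i+j}>0$, $0<s_{i+1}\le\cdots\le s_{i+j}<1$ and $C^2+S^2=I_j$, for some nonnegative integers $r,i,j$. Moreover, $\boldsymbol{Q},\boldsymbol{X}_{\boldsymbol{A}},\boldsymbol{X}_{\boldsymbol{B}}$ have the form $$\boldsymbol{Q}=(\boldsymbol{Q}_{\boldsymbol{B}},\hat{\boldsymbol{Q}}_{\boldsymbol{B}})\begin{pmatrix}\boldsymbol{U}_1&0\\0&\boldsymbol{U}_2\end{pmatrix},\quad \boldsymbol{X}_{\boldsymbol{A}}=\begin{pmatrix}\boldsymbol{V}_1^*&0\\0&I_{n-p}\end{pmatrix}\begin{pmatrix}\boldsymbol{R}_1\\ \hat{\boldsymbol{R}}_1\end{pmatrix},\quad \boldsymbol{X}_{\boldsymbol{B}}=\begin{pmatrix}\boldsymbol{U}_1^*&0\\0&I_{l-q}\end{pmatrix}\begin{pmatrix}\boldsymbol{R}_2\\ \hat{\boldsymbol{R}}_2\end{pmatrix},$$ where $\boldsymbol{A}=\boldsymbol{Q}_{\boldsymbol{A}}\boldsymbol{R}_1$ and $\boldsymbol{B}=\boldsymbol{Q}_{\boldsymbol{B}}\boldsymbol{R}_2$ are unitary decompositions ($\boldsymbol{Q}_{\boldsymbol{A}}\in\mathbb{DQ}^{m\times p}$, $\boldsymbol{R}_1\in\mathbb{DQ}^{p\times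 n}$, $\boldsymbol{Q}_{\boldsymbol{B}}\in\mathbb{DQ}^{m\times q}$, $\boldsymbol{R}_2\in\mathbb{DQ}^{q\times l}$), $\hat{\boldsymbol{R}}_1\in\mathbb{DQ}^{(n-p)\times n}$, $\hat{\boldsymbol{R}}_2\in\mathbb{DQ}^{(l-q)\times l}$, $(\boldsymbol{Q}_{\boldsymbol{B}},\hat{\boldsymbol{Q}}_{\boldsymbol{B}})\in\mathbb{DQ}^{m\times m}$ is unitary, and $\boldsymbol{U}_1\in\mathbb{DQ}^{q\times q}$, $\boldsymbol{U}_2\in\mathbb{DQ}^{(m-q)\times(m-q)}$, $\boldsymbol{V}_1\in\mathbb{DQ}^{p\times p}$ are unitary.
   Context: Dual numbers: $\mathbb{D}=\{a+b\epsilon: a,b\in\mathbb{R}\}$ with $\epsilon\neq0$, $\epsilon^2=0$; $a+b\epsilon$ is appreciable if $a\ne0$ and infinitesimal otherwise. $\mathbb{D}$ is totally ordered lexicographically: $a+b\epsilon>a'+b'\epsilon$ iff $a>a'$, or $a=a'$ and $b>b'$. $\mathbb{Q}$ denotes the real (Hamilton) quaternions, and $\mathbb{DQ}=\{\mathbf{q}_{st}+\mathbf{q}_{in}\epsilon:\mathbf{q}_{st},\mathbf{q}_{in}\in\mathbb{Q}\}$ the dual quaternions, where $\epsilon$ commutes with quaternions; conjugation is $\mathbf{q}_{st}^*+\mathbf{q}_{in}^*\epsilon$. For a matrix $\boldsymbol{A}$ over $\mathbb{DQ}$, $\boldsymbol{A}^*$ is its conjugate transpose. A square $\boldsymbol{U}$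 is unitary if $\boldsymbol{U}^*\boldsymbol{U}=\boldsymbol{U}\boldsymbol{U}^*=I$. Rank: every $\boldsymbol{A}\in\mathbb{DQ}^{m\times n}$ has a singular value decomposition (known) $\boldsymbol{U}^*\boldsymbol{A}\boldsymbol{V}=\begin{pmatrix}\mathrm{diag}(\mu_1,\dots,\mu_t)&0\\0&0\end{pmatrix}$ with $\boldsymbol{U},\boldsymbol{V}$ unitary and $\mu_1\ge\cdots\ge\mu_t$ positive dual numbers (the first of them appreciable, the remaining ones infinitesimal); the $\mu_i$ are unique, and $\mathrm{rank}(\boldsymbol{A})=t$. Unitary decomposition: for $\boldsymbol{A}\in\mathbb{DQ}^{m\times n}$ of rank $p$, a factorization $\boldsymbol{A}=\boldsymbol{Q}_1\widetilde{\boldsymbol{R}}$ in which $\boldsymbol{Q}_1\in\mathbb{DQ}^{m\times p}$ satisfies $\boldsymbol{Q}_1^*\boldsymbol{Q}_1=I_p$ and $\widetilde{\boldsymbol{R}}=\boldsymbol{R}\Pi^T\in\mathbb{DQ}^{p\times n}$ with $\Pi$ a permutation matrix and $\boldsymbol{R}$ upper trapezoidal (entries below the main diagonal are zero). $I$ and $0$ denote identity and zero blocks of suitable size; zero blocks may be rectangular, and blocks with zero rows or columns are allowed (empty). *)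

theory Defs
  imports "Jordan_Normal_Form.Matrix"
begin

datatype quat = Quat (qre: real) (qi: real) (qj: real) (qk: real)

instantiation quat :: real_algebra_1
begin

definition "0 = Quat 0 0 0 0"
definition "1 = Quat 1 0 0 0"
definition "x + y = Quat (qre x + qre y) (qi x + qi y) (qj x + qj y) (qk x + qk y)"
definition "- x = Quat (- qre x) (- qi x) (- qj x) (- qk x)"
definition "x - y = Quat (qre x - qre y) (qi x - qi y) (qj x - qj y) (qk x - qk y)"
definition "x * y = Quat
  (qre x * qre y - qi x * qi y - qj x * qj y - qk x * qk y)
  (qre x * qi y + qi x * qre y + qj x * qk y - qk x * qj y)
  (qre x * qj y - qi x * qk y + qj x * qre y + qk x * qi y)
  (qre x * qk y + qi x * qj y - qj x * qi y + qk x * qre y)"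
definition "c *\<^sub>R x = Quat (c * qre x) (c * qi x) (c * qj x) (c * qk x)"

instance
  by standard
    (simp_all add: zero_quat_def one_quat_def plus_quat_def uminus_quat_def minus_quat_def
      times_quat_def scaleR_quat_def algebra_simps)

end

instantiation quat :: conjugate
begin

definition "conjugate x = Quat (qre x) (- qi x) (- qj x) (- qk x)"

instance
  by standard (auto simp: conjugate_quat_def intro: quat.expand)

end

text \<open>\<open>Dual a b\<close> is \<open>a + b \<epsilon>\<close> with \<open>\<epsilon>\<close> central and \<open>\<epsilon>\<^sup>2 = 0\<close>. The dual numbers are
  \<open>real dual\<close>; the dual quaternions are \<open>quat dual\<close>.\<close>

datatype 'a dual = Dual (std_part: 'a) (dual_part: 'a)

type_synonym dual_number = "real dual"
type_synonym dual_quat = "quat dual"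

instantiation dual :: (ring_1) ring_1
begin

definition "0 = Dual 0 0"
definition "1 = Dual 1 0"
definition "x + y = Dual (std_part x + std_part y) (dual_part x + dual_part y)"
definition "- x = Dual (- std_part x) (- dual_part x)"
definition "x - y = Dual (std_part x - std_part y) (dual_part x - dual_part y)"
definition "x * y = Dual (std_part x * std_part y)
  (std_part x * dual_part y + dual_part x * std_part y)"

instance
  by standard
    (simp_all add: zero_dual_def one_dual_def plus_dual_def uminus_dual_def minus_dual_def
      times_dual_def algebra_simps)

end

instance dual :: (comm_ring_1) comm_ring_1
  by standard (simp_all add: one_dual_def plus_dual_def times_dual_def algebra_simps)

instantiation dual :: (real_algebra_1) real_algebra_1
begin

definition "c *\<^sub>R x = Dual (c *\<^sub>R std_part x) (c *\<^sub>R dual_part x)"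

instance
  by standard
    (simp_all add: plus_dual_def times_dual_def scaleR_dual_def algebra_simps)

end

instantiation dual :: (conjugate) conjugate
begin

definition "conjugate x = Dual (conjugate (std_part x)) (conjugate (dual_part x))"

instance
  by standard (auto simp: conjugate_dual_def intro: dual.expand)

end

instantiation dual :: (linorder) linorder
begin

definition "x < y \<longleftrightarrow>
  std_part x < std_part y \<or> std_part x = std_part y \<and> dual_part x < dual_part y"
definition "x \<le> y \<longleftrightarrow> x < y \<or> x = (y :: 'a dual)"

instance
  by standard (auto simp: less_dual_def less_eq_dual_def intro: dual.expand)

end

definition dual_eps :: "'a :: ring_1 dual" (\<open>\<epsilon>\<close>) where
  "\<epsilon> = Dual 0 1"

definition appreciable :: "'a :: zero dual \<Rightarrow> bool" where
  "appreciable x \<longleftrightarrow> std_part x \<noteq> 0"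

definition dq_of_dual :: "dual_number \<Rightarrow> dual_quat" where
  "dq_of_dual = map_dual of_real"

definition append_cols :: "'a :: zero mat \<Rightarrow> 'a mat \<Rightarrow> 'a mat" (infixr \<open>@\<^sub>c\<close> 66) where
  "A @\<^sub>c B = four_block_mat A B (0\<^sub>m 0 (dim_col A)) (0\<^sub>m 0 (dim_col B))"

definition diag_of_list :: "'a :: zero list \<Rightarrow> 'a mat" where
  "diag_of_list xs = mat_diag (length xs) (\<lambda>k. xs ! k)"

definition conj_transpose :: "'a :: conjugate mat \<Rightarrow> 'a mat" where
  "conj_transpose A = map_mat conjugate (transpose_mat A)"

definition unitary_mat :: "nat \<Rightarrow> 'a :: {ring_1, conjugate} mat \<Rightarrow> bool" where
  "unitary_mat n U \<longleftrightarrow> U \<in> carrier_mat n n \<and>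
     conj_transpose U * U = 1\<^sub>m n \<and> U * conj_transpose U = 1\<^sub>m n"

definition permutation_mat :: "nat \<Rightarrow> 'a :: {zero, one} mat \<Rightarrow> bool" where
  "permutation_mat n P \<longleftrightarrow>
     (\<exists>\<pi>. \<pi> permutes {..<n} \<and> P = mat n n (\<lambda>(i, j). if i = \<pi> j then 1 else 0))"

definition upper_trapezoidal :: "'a :: zero mat \<Rightarrow> bool" where
  "upper_trapezoidal R \<longleftrightarrow> (\<forall>i < dim_row R. \<forall>j < dim_col R. j < i \<longrightarrow> R $$ (i, j) = 0)"

text \<open>The list \<open>\<mu>s\<close> holds the positive singular values in decreasing order. In the lexicographic
  order every positive appreciable number exceeds every infinitesimal one, so the appreciable
  singular values automatically come first.\<close>

definition dq_svd ::
  "dual_quat mat \<Rightarrow> dual_quat mat \<Rightarrow> dual_quat mat \<Rightarrow> dual_number list \<Rightarrow> bool" where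
  "dq_svd A U V \<mu>s \<longleftrightarrow>
     (let m = dim_row A; n = dim_col A; t = length \<mu>s in
       unitary_mat m U \<and> unitary_mat n V \<and> t \<le> m \<and> t \<le> n \<and>
       sorted_wrt (\<ge>) \<mu>s \<and> (\<forall>\<mu> \<in> set \<mu>s. \<mu> > 0) \<and>
       conj_transpose U * A * V =
         four_block_mat (diag_of_list (map dq_of_dual \<mu>s)) (0\<^sub>m t (n - t))
           (0\<^sub>m (m - t) t) (0\<^sub>m (m - t) (n - t)))"

text \<open>Every matrix has a singular value decomposition, and all its decompositions have the same
  singular values; hence the choice below does not matter.\<close>

definition dq_rank :: "dual_quat mat \<Rightarrow> nat" where
  "dq_rank A = (SOME t. \<exists>U V \<mu>s. dq_svd A U V \<mu>s \<and> length \<mu>s = t)"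

definition unitary_decomposition ::
  "dual_quat mat \<Rightarrow> dual_quat mat \<Rightarrow> dual_quat mat \<Rightarrow> bool" where
  "unitary_decomposition A Q1 R' \<longleftrightarrow>
     (let m = dim_row A; n = dim_col A; p = dq_rank A in
       Q1 \<in> carrier_mat m p \<and> R' \<in> carrier_mat p n \<and>
       A = Q1 * R' \<and> conj_transpose Q1 * Q1 = 1\<^sub>m p \<and>
       (\<exists>R P. R \<in> carrier_mat p n \<and> upper_trapezoidal R \<and> permutation_mat n P \<and>
          R' = R * transpose_mat P))"

text \<open>The \<open>m \<times> p\<close> block matrix \<open>\<Sigma>\<^sub>A\<close>. Its block columns have widths \<open>r\<close>, \<open>i - r\<close>, \<open>j\<close>, \<open>k\<close>,
  \<open>p - i - j - k\<close>; the first five block rows make up the first \<open>q\<close> rows. The subtractions are exact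
  if \<open>r \<le> i\<close>, \<open>i + j + k \<le> p\<close>, \<open>i + j + k \<le> q \<le> m\<close> and \<open>r + (p - i) \<le> m - q\<close>.\<close>

definition Sigma_A ::
  "nat \<Rightarrow> nat \<Rightarrow> nat \<Rightarrow> nat \<Rightarrow> nat \<Rightarrow> nat \<Rightarrow> nat \<Rightarrow>
   dual_quat mat \<Rightarrow> dual_quat mat \<Rightarrow> dual_quat mat \<Rightarrow> dual_quat mat \<Rightarrow> dual_quat mat" where
  "Sigma_A m p q r i j k \<Sigma> D C S =
     (let i' = i - r; e = p - i - j - k; y = q - i - j - k; z = m - q - r - (p - i) in
       (1\<^sub>m r    @\<^sub>c 0\<^sub>m r i' @\<^sub>c 0\<^sub>m r j  @\<^sub>c 0\<^sub>m r k  @\<^sub>c 0\<^sub>m r e) @\<^sub>r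
       (0\<^sub>m i' r @\<^sub>c 1\<^sub>m i'   @\<^sub>c 0\<^sub>m i' j @\<^sub>c 0\<^sub>m i' k @\<^sub>c 0\<^sub>m i' e) @\<^sub>r
       (0\<^sub>m j r  @\<^sub>c 0\<^sub>m j i' @\<^sub>c C       @\<^sub>c 0\<^sub>m j k  @\<^sub>c 0\<^sub>m j e) @\<^sub>r
       (0\<^sub>m k r  @\<^sub>c 0\<^sub>m k i' @\<^sub>c 0\<^sub>m k j  @\<^sub>c (\<epsilon> \<cdot>\<^sub>m D) @\<^sub>c 0\<^sub>m k e) @\<^sub>r
       (0\<^sub>m y r  @\<^sub>c 0\<^sub>m y i' @\<^sub>c 0\<^sub>m y j  @\<^sub>c 0\<^sub>m y k  @\<^sub>c 0\<^sub>m y e) @\<^sub>r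
       ((\<epsilon> \<cdot>\<^sub>m \<Sigma>) @\<^sub>c 0\<^sub>m r i' @\<^sub>c 0\<^sub>m r j @\<^sub>c 0\<^sub>m r k  @\<^sub>c 0\<^sub>m r e) @\<^sub>r
       (0\<^sub>m z r  @\<^sub>c 0\<^sub>m z i' @\<^sub>c 0\<^sub>m z j  @\<^sub>c 0\<^sub>m z k  @\<^sub>c 0\<^sub>m z e) @\<^sub>r
       (0\<^sub>m j r  @\<^sub>c 0\<^sub>m j i' @\<^sub>c S       @\<^sub>c 0\<^sub>m j k  @\<^sub>c 0\<^sub>m j e) @\<^sub>r
       (0\<^sub>m k r  @\<^sub>c 0\<^sub>m k i' @\<^sub>c 0\<^sub>m k j  @\<^sub>c 1\<^sub>m k    @\<^sub>c 0\<^sub>m k e) @\<^sub>r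
       (0\<^sub>m e r  @\<^sub>c 0\<^sub>m e i' @\<^sub>c 0\<^sub>m e j  @\<^sub>c 0\<^sub>m e k  @\<^sub>c 1\<^sub>m e))"

definition Sigma_B :: "nat \<Rightarrow> nat \<Rightarrow> dual_quat mat" where
  "Sigma_B m q = 1\<^sub>m q @\<^sub>r 0\<^sub>m (m - q) q"

end

theory Submission
  imports Defs "HOL-Analysis.Function_Topology"
begin

text \<open>Write \<open>A = Q\<^sub>A R\<^sub>1\<close> and \<open>B = Q\<^sub>B R\<^sub>2\<close> for unitary decompositions and complete \<open>Q\<^sub>B\<close> to a unitary
  matrix \<open>G\<close>. The matrix \<open>G\<^sup>* Q\<^sub>A\<close> has orthonormal columns. It consists of \<open>q\<close> rows \<open>W\<^sub>1\<close> above
  \<open>m - q\<close> rows \<open>W\<^sub>2\<close>, so the theorem amounts to a CS decomposition of this pair: unitary \<open>U\<^sub>1, U\<^sub>2, V\<^sub>1\<close>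
  that bring \<open>W\<^sub>1\<close> and \<open>W\<^sub>2\<close> to the upper and the lower part of \<open>\<Sigma>\<^sub>A\<close>
  (\<open>dual_quat_cs_decomposition\<close>).

  A singular value decomposition of \<open>W\<^sub>1\<close> gives its singular values \<open>\<mu>\<close>, which fall into three ranges:
  \<open>\<mu> = 1\<close>, appreciable \<open>\<mu> < 1\<close>, and infinitesimal \<open>\<mu>\<close> (including \<open>0\<close>). The columns of \<open>W\<^sub>2 V\<close> are then
  orthogonal with squared lengths \<open>1 - \<mu>\<^sup>2\<close>. In the last two ranges these lengths are invertible; the
  normalised columns yield the blocks \<open>S\<close> and \<open>I\<close>. A column with \<open>\<mu> = 1\<close> has length \<open>0\<close>, which over
  the dual numbers only says that it is infinitesimal; these columns are diagonalised by a further
  singular value decomposition, which yields \<open>\<Sigma>\<epsilon>\<close>. It rotates the columns among themselves, and this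
  can be compensated in \<open>U\<^sub>1\<close> because the upper part is the identity there.

  Everything rests on the singular value decomposition over the dual quaternions
  (\<open>dual_quat_svd\<close>), from which the unitary decomposition (\<open>unitary_decomposition_exists\<close>) and the
  completion of orthonormal columns (\<open>unitary_completion\<close>) also follow. It is obtained by splitting off
  singular pairs, and a singular pair of \<open>A\<close> comes from an eigenvector of \<open>A\<^sup>* A\<close> with appreciable
  eigenvalue, or from one of \<open>A/\<epsilon>\<close> if \<open>A\<close> is infinitesimal. Such an eigenvector is found by first-order
  perturbation theory (\<open>dual_hermitian_eigenvector\<close>) from the spectral theorem for Hermitian quaternion
  matrices, and this in turn from the maximum of the Rayleigh quotient on the unit sphere
  (\<open>quat_hermitian_eigenvector\<close>).\<close>

section \<open>Rings with a conjugation\<close>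

text \<open>Conjugation of quaternions reverses products, and their order matters because quaternions do
  not commute.\<close>

class star_ring = ring_1 + conjugate +
  assumes star_add: "conjugate (x + y) = conjugate x + conjugate y"
    and star_mult: "conjugate (x * y) = conjugate y * conjugate x"
begin

lemma star_zero [simp]: "conjugate 0 = 0"
  using star_add[of 0 0] by simp

lemma star_one [simp]: "conjugate 1 = 1"
  using star_mult[of "conjugate 1" 1] by simp

lemma star_uminus: "conjugate (- x) = - conjugate x"
  using star_add[of x "- x"] by (simp add: eq_neg_iff_add_eq_0 add.commute)

lemma star_diff: "conjugate (x - y) = conjugate x - conjugate y"
  using star_add[of x "- y"] by (simp add: star_uminus)

lemma star_sum: "conjugate (sum f X) = (\<Sum>x\<in>X. conjugate (f x))"
  by (induct X rule: infinite_finite_induct) (auto simp: star_add)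

end

text \<open>In a local ring in which \<open>2\<close> is invertible, \<open>1 - x\<close> and \<open>1 + x\<close> cannot both be non-units,
  because their sum is \<open>2\<close>. Stated in this form, the property is what the construction of unitary
  matrices needs; the quaternions have it as a division ring, and it passes from a ring to its dual
  extension.\<close>

class star_local_ring = star_ring +
  assumes one_minus_or_one_plus_unit:
    "(\<exists>y. (1 - x) * y = 1 \<and> y * (1 - x) = 1) \<or> (\<exists>y. (1 + x) * y = 1 \<and> y * (1 + x) = 1)"

lemmas quat_defs = zero_quat_def one_quat_def plus_quat_def uminus_quat_def minus_quat_def
  times_quat_def scaleR_quat_def conjugate_quat_def

lemma quat_eq_iff: "x = y \<longleftrightarrow> qre x = qre y \<and> qi x = qi y \<and> qj x = qj y \<and> qk x = qk y"
  by (auto intro: quat.expand)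

definition qnorm2 :: "quat \<Rightarrow> real" where
  "qnorm2 x = (qre x)\<^sup>2 + (qi x)\<^sup>2 + (qj x)\<^sup>2 + (qk x)\<^sup>2"

lemma conjugate_times_quat: "conjugate x * x = of_real (qnorm2 x)"
  and times_conjugate_quat: "x * conjugate x = of_real (qnorm2 x)"
  by (simp_all add: quat_eq_iff quat_defs of_real_def qnorm2_def power2_eq_square)

lemma qnorm2_nonneg [simp]: "qnorm2 x \<ge> 0"
  by (simp add: qnorm2_def)

lemma qnorm2_eq_0_iff [simp]: "qnorm2 x = 0 \<longleftrightarrow> x = 0"
  by (auto simp: qnorm2_def quat_eq_iff zero_quat_def add_nonneg_eq_0_iff)

lemma quat_unit:
  assumes "x \<noteq> (0::quat)"
  shows "\<exists>y. x * y = 1 \<and> y * x = 1"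
proof -
  let ?y = "(1 / qnorm2 x) *\<^sub>R conjugate x"
  have "x * ?y = 1" "?y * x = 1"
    using assms by (simp_all add: conjugate_times_quat times_conjugate_quat of_real_def)
  then show ?thesis by blast
qed

instance quat :: star_local_ring
proof
  fix x y :: quat
  show "conjugate (x + y) = conjugate x + conjugate y"
    "conjugate (x * y) = conjugate y * conjugate x"
    by (simp_all add: quat_defs)
  have "1 - x \<noteq> 0 \<or> 1 + x \<noteq> 0"
    by (auto simp: quat_eq_iff quat_defs)
  then show "(\<exists>y. (1 - x) * y = 1 \<and> y * (1 - x) = 1) \<or> (\<exists>y. (1 + x) * y = 1 \<and> y * (1 + x) = 1)"
    using quat_unit by blast
qed

lemmas dual_defs = zero_dual_def one_dual_def plus_dual_def uminus_dual_def minus_dual_def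
  times_dual_def conjugate_dual_def

lemma dual_eq_iff: "x = y \<longleftrightarrow> std_part x = std_part y \<and> dual_part x = dual_part y"
  by (auto intro: dual.expand)

lemma dual_parts [simp]:
  "std_part 0 = 0" "dual_part 0 = 0" "std_part 1 = 1" "dual_part 1 = 0"
  "std_part (x + y) = std_part x + std_part y" "dual_part (x + y) = dual_part x + dual_part y"
  "std_part (x - y) = std_part x - std_part y" "dual_part (x - y) = dual_part x - dual_part y"
  "std_part (- x) = - std_part x" "dual_part (- x) = - dual_part x"
  "std_part (x * y) = std_part x * std_part y"
  "dual_part (x * y) = std_part x * dual_part y + dual_part x * std_part y"
  "std_part (conjugate z) = conjugate (std_part z)"
  "dual_part (conjugate z) = conjugate (dual_part z)"
  by (simp_all add: dual_defs)

lemma dual_parts_sum: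
  "std_part (sum f X) = (\<Sum>x\<in>X. std_part (f x))"
  "dual_part (sum f X) = (\<Sum>x\<in>X. dual_part (f x))"
  by (induct X rule: infinite_finite_induct) auto

text \<open>A dual element is invertible as soon as its standard part is: a unit stays a unit under a
  nilpotent perturbation.\<close>

lemma dual_unit:
  fixes x :: "'a :: ring_1 dual"
  assumes "std_part x * y = 1" "y * std_part x = 1"
  shows "\<exists>z. x * z = 1 \<and> z * x = 1"
proof -
  let ?z = "Dual y (- (y * dual_part x * y))"
  have "std_part x * (y * dual_part x * y) = (std_part x * y) * dual_part x * y"
    "(y * dual_part x * y) * std_part x = y * dual_part x * (y * std_part x)"
    by (simp_all only: mult.assoc)
  then have "x * ?z = 1" "?z * x = 1"
    using assms by (simp_all add: dual_eq_iff)
  then show ?thesis by blast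
qed

instance dual :: (star_local_ring) star_local_ring
proof
  fix x y :: "'a dual"
  show "conjugate (x + y) = conjugate x + conjugate y"
    "conjugate (x * y) = conjugate y * conjugate x"
    by (simp_all add: dual_eq_iff star_add star_mult add.commute)
  show "(\<exists>y. (1 - x) * y = 1 \<and> y * (1 - x) = 1) \<or> (\<exists>y. (1 + x) * y = 1 \<and> y * (1 + x) = 1)"
    using one_minus_or_one_plus_unit[of "std_part x"]
      dual_unit[of "1 - x"] dual_unit[of "1 + x"] by auto
qed

section \<open>Matrices over a ring with conjugation\<close>

text \<open>The library states the laws of matrix arithmetic with explicit carriers. The variants below
  have dimension conditions instead, which rewriting can discharge.\<close>

lemma mat_mult_assoc:
  fixes A B C :: "'a :: semiring_0 mat"
  shows "dim_col A = dim_row B \<Longrightarrow> dim_col B = dim_row C \<Longrightarrow> A * B * C = A * (B * C)"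
  by (rule assoc_mult_mat[of A "dim_row A" "dim_row B" B "dim_row C" C "dim_col C"]) auto

text \<open>Entries of products are written as sums below; the simplification rule that turns them into
  scalar products of rows and columns is switched off where this law is used.\<close>

lemma mat_entry_mult:
  "a < dim_row A \<Longrightarrow> b < dim_col B \<Longrightarrow> dim_col A = dim_row B \<Longrightarrow>
   (A * B) $$ (a, b) = (\<Sum>k<dim_row B. A $$ (a, k) * B $$ (k, b))"
  by (simp add: scalar_prod_def atLeast0LessThan)

lemma dim_conj_transpose [simp]:
  "dim_row (conj_transpose A) = dim_col A" "dim_col (conj_transpose A) = dim_row A"
  by (simp_all add: conj_transpose_def)

lemma conj_transpose_carrier [simp]:
  "A \<in> carrier_mat m n \<Longrightarrow> conj_transpose A \<in> carrier_mat n m"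
  by auto

lemma conj_transpose_entry [simp]:
  "a < dim_col A \<Longrightarrow> b < dim_row A \<Longrightarrow> conj_transpose A $$ (a, b) = conjugate (A $$ (b, a))"
  by (simp add: conj_transpose_def)

lemma conj_transpose_conj_transpose [simp]: "conj_transpose (conj_transpose A) = A"
  by (rule eq_matI) auto

lemma conj_transpose_mult:
  fixes A B :: "'a :: star_ring mat"
  assumes "dim_col A = dim_row B"
  shows "conj_transpose (A * B) = conj_transpose B * conj_transpose A"
  using assms by (intro eq_matI) (auto simp: mat_entry_mult star_sum star_mult simp del: index_mult_mat(1))

lemma conj_transpose_one [simp]: "conj_transpose (1\<^sub>m n :: 'a :: star_ring mat) = 1\<^sub>m n"
  by (rule eq_matI) auto

lemma conj_transpose_zero [simp]: "conj_transpose (0\<^sub>m m n :: 'a :: star_ring mat) = 0\<^sub>m n m"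
  by (rule eq_matI) auto

lemma conj_transpose_four_block:
  assumes "A \<in> carrier_mat a c" "B \<in> carrier_mat a d" "C \<in> carrier_mat b c" "D \<in> carrier_mat b d"
  shows "conj_transpose (four_block_mat A B C D) =
    four_block_mat (conj_transpose A) (conj_transpose C) (conj_transpose B) (conj_transpose D)"
  using assms by (intro eq_matI) auto

lemma append_cols_carrier [simp]:
  "A \<in> carrier_mat m a \<Longrightarrow> B \<in> carrier_mat m b \<Longrightarrow> A @\<^sub>c B \<in> carrier_mat m (a + b)"
  by (rule carrier_matI) (auto simp: append_cols_def)

lemma dim_append_cols [simp]:
  "dim_row (A @\<^sub>c B) = dim_row A" "dim_col (A @\<^sub>c B) = dim_col A + dim_col B"
  by (simp_all add: append_cols_def)

lemma dim_append_rows [simp]: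
  "dim_row (A @\<^sub>r B) = dim_row A + dim_row B" "dim_col (A @\<^sub>r B) = dim_col A"
  by (simp_all add: append_rows_def)

lemma append_cols_entry:
  "a < dim_row A \<Longrightarrow> dim_row B = dim_row A \<Longrightarrow> b < dim_col A + dim_col B \<Longrightarrow>
   (A @\<^sub>c B) $$ (a, b) = (if b < dim_col A then A $$ (a, b) else B $$ (a, b - dim_col A))"
  by (simp add: append_cols_def)

lemma append_rows_entry:
  "a < dim_row A + dim_row B \<Longrightarrow> b < dim_col A \<Longrightarrow>
   (A @\<^sub>r B) $$ (a, b) = (if a < dim_row A then A $$ (a, b) else B $$ (a - dim_row A, b))"
  by (simp add: append_rows_def)

lemma mult_append_cols:
  fixes A :: "'a :: semiring_0 mat"
  assumes "dim_col A = dim_row B" "dim_row C = dim_row B"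
  shows "A * (B @\<^sub>c C) = A * B @\<^sub>c A * C"
  using assms by (intro eq_matI) (auto simp: append_cols_entry mat_entry_mult simp del: index_mult_mat(1))

lemma append_rows_mult:
  fixes A :: "'a :: semiring_0 mat"
  assumes "dim_col A = dim_row C" "dim_col B = dim_row C"
  shows "(A @\<^sub>r B) * C = A * C @\<^sub>r B * C"
  using assms by (intro eq_matI) (auto simp: append_rows_entry mat_entry_mult simp del: index_mult_mat(1))

lemma append_rows_mult_append_cols:
  fixes A :: "'a :: semiring_0 mat"
  assumes "A \<in> carrier_mat a n" "B \<in> carrier_mat b n" "C \<in> carrier_mat n c" "D \<in> carrier_mat n d"
  shows "(A @\<^sub>r B) * (C @\<^sub>c D) = four_block_mat (A * C) (A * D) (B * C) (B * D)"
  using assms by (intro eq_matI)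
    (auto simp: append_rows_entry append_cols_entry mat_entry_mult simp del: index_mult_mat(1))

lemma sum_split_nat: "(\<Sum>k<a + b. f k) = (\<Sum>k<a. f k) + (\<Sum>k<b. f (a + k :: nat) :: 'a :: comm_monoid_add)"
  by (induct b) (auto simp: add.assoc)

lemma append_cols_mult_append_rows:
  fixes A :: "'a :: semiring_0 mat"
  assumes "A \<in> carrier_mat m a" "B \<in> carrier_mat m b" "C \<in> carrier_mat a n" "D \<in> carrier_mat b n"
  shows "(A @\<^sub>c B) * (C @\<^sub>r D) = A * C + B * D"
  using assms by (intro eq_matI)
    (auto simp: append_rows_entry append_cols_entry mat_entry_mult sum_split_nat simp del: index_mult_mat(1))

lemma conj_transpose_append_cols:
  assumes "dim_row A = dim_row B"
  shows "conj_transpose (A @\<^sub>c B) = conj_transpose A @\<^sub>r conj_transpose B"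
  using assms by (intro eq_matI) (auto simp: append_rows_entry append_cols_entry)

lemma append_cols_mult_block_diag:
  fixes A :: "'a :: semiring_0 mat"
  assumes "A \<in> carrier_mat m a" "B \<in> carrier_mat m b" "C \<in> carrier_mat a c" "D \<in> carrier_mat b d"
  shows "(A @\<^sub>c B) * four_block_mat C (0\<^sub>m a d) (0\<^sub>m b c) D = A * C @\<^sub>c B * D"
  using assms by (intro eq_matI)
    (auto simp: append_rows_entry append_cols_entry mat_entry_mult sum_split_nat simp del: index_mult_mat(1))

lemma four_block_eq_iff:
  assumes "A \<in> carrier_mat a c" "B \<in> carrier_mat a d" "C \<in> carrier_mat b c" "D \<in> carrier_mat b d"
    "A' \<in> carrier_mat a c" "B' \<in> carrier_mat a d" "C' \<in> carrier_mat b c" "D' \<in> carrier_mat b d"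
  shows "four_block_mat A B C D = four_block_mat A' B' C' D' \<longleftrightarrow> A = A' \<and> B = B' \<and> C = C' \<and> D = D'"
proof
  assume eq: "four_block_mat A B C D = four_block_mat A' B' C' D'"
  note entry = arg_cong[OF eq, of "\<lambda>M. M $$ (x, y)" for x y]
  have "A $$ (x, y) = A' $$ (x, y)" if "x < a" "y < c" for x y
    using entry[of x y] that assms by auto
  moreover have "B $$ (x, y) = B' $$ (x, y)" if "x < a" "y < d" for x y
    using entry[of x "c + y"] that assms by auto
  moreover have "C $$ (x, y) = C' $$ (x, y)" if "x < b" "y < c" for x y
    using entry[of "a + x" y] that assms by auto
  moreover have "D $$ (x, y) = D' $$ (x, y)" if "x < b" "y < d" for x y
    using entry[of "a + x" "c + y"] that assms by auto
  ultimately show "A = A' \<and> B = B' \<and> C = C' \<and> D = D'"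
    using assms by (auto intro!: eq_matI)
qed simp

lemma split_cols:
  assumes "M \<in> carrier_mat m (a + b)"
  obtains X Y where "X \<in> carrier_mat m a" "Y \<in> carrier_mat m b" "M = X @\<^sub>c Y"
proof
  let ?X = "mat m a (\<lambda>(i, j). M $$ (i, j))" and ?Y = "mat m b (\<lambda>(i, j). M $$ (i, a + j))"
  show "?X \<in> carrier_mat m a" "?Y \<in> carrier_mat m b" by auto
  show "M = ?X @\<^sub>c ?Y"
    using assms by (intro eq_matI) (auto simp: append_cols_entry)
qed

section \<open>Unitary matrices\<close>

lemma unitary_matD:
  assumes "unitary_mat n U"
  shows "U \<in> carrier_mat n n" "dim_row U = n" "dim_col U = n"
    "conj_transpose U * U = 1\<^sub>m n" "U * conj_transpose U = 1\<^sub>m n"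
  using assms by (auto simp: unitary_mat_def)

lemma unitary_cancel:
  fixes U :: "'a :: star_ring mat"
  assumes "unitary_mat n U" "dim_row X = n"
  shows "conj_transpose U * (U * X) = X" "U * (conj_transpose U * X) = X"
proof -
  have "conj_transpose U * (U * X) = (conj_transpose U * U) * X"
    "U * (conj_transpose U * X) = (U * conj_transpose U) * X"
    using unitary_matD(2,3)[OF assms(1)] assms(2) by (simp_all add: mat_mult_assoc)
  then show "conj_transpose U * (U * X) = X" "U * (conj_transpose U * X) = X"
    by (simp_all only: unitary_matD[OF assms(1)] left_mult_one_mat'[OF assms(2)])
qed

lemma unitary_one [simp]: "unitary_mat n (1\<^sub>m n :: 'a :: star_ring mat)"
  by (simp add: unitary_mat_def)

lemma unitary_conj_transpose: "unitary_mat n U \<Longrightarrow> unitary_mat n (conj_transpose U)"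
  by (simp add: unitary_mat_def)

lemma unitary_mult:
  fixes U V :: "'a :: star_ring mat"
  assumes U: "unitary_mat n U" and V: "unitary_mat n V"
  shows "unitary_mat n (U * V)"
  unfolding unitary_mat_def
  using unitary_matD[OF U] unitary_matD[OF V]
  by (auto simp: conj_transpose_mult mat_mult_assoc unitary_cancel[OF U] unitary_cancel[OF V])

lemma unitary_block_diag:
  fixes U V :: "'a :: star_ring mat"
  assumes U: "unitary_mat a U" and V: "unitary_mat b V"
  shows "unitary_mat (a + b) (four_block_mat U (0\<^sub>m a b) (0\<^sub>m b a) V)"
proof -
  note D = unitary_matD[OF U] unitary_matD[OF V]
  note mult = mult_four_block_mat[of _ a a _ b _ b _ _ a _ b]
  show ?thesis
    unfolding unitary_mat_def using D
    by (auto simp: conj_transpose_four_block[of U a a _ b _ b] mult four_block_one_mat)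
qed

text \<open>Being unitary is a symmetric condition on the two blocks of columns, so the blocks may be
  exchanged.\<close>

lemma unitary_append_cols_iff:
  fixes X Y :: "'a :: star_ring mat"
  assumes X: "X \<in> carrier_mat (a + b) a" and Y: "Y \<in> carrier_mat (a + b) b"
  shows "unitary_mat (a + b) (X @\<^sub>c Y) \<longleftrightarrow>
    conj_transpose X * X = 1\<^sub>m a \<and> conj_transpose Y * Y = 1\<^sub>m b \<and>
    conj_transpose X * Y = 0\<^sub>m a b \<and> conj_transpose Y * X = 0\<^sub>m b a \<and>
    X * conj_transpose X + Y * conj_transpose Y = 1\<^sub>m (a + b)"
proof -
  have 1: "conj_transpose (X @\<^sub>c Y) * (X @\<^sub>c Y) =
      four_block_mat (conj_transpose X * X) (conj_transpose X * Y)
        (conj_transpose Y * X) (conj_transpose Y * Y)"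
    using X Y by (simp add: conj_transpose_append_cols append_rows_mult_append_cols[of _ a "a + b" _ b _ a _ b])
  have 2: "(X @\<^sub>c Y) * conj_transpose (X @\<^sub>c Y) = X * conj_transpose X + Y * conj_transpose Y"
    using X Y by (simp add: conj_transpose_append_cols append_cols_mult_append_rows[of _ "a + b" a _ b _ "a + b"])
  have 3: "four_block_mat (conj_transpose X * X) (conj_transpose X * Y)
        (conj_transpose Y * X) (conj_transpose Y * Y) = 1\<^sub>m (a + b) \<longleftrightarrow>
    conj_transpose X * X = 1\<^sub>m a \<and> conj_transpose X * Y = 0\<^sub>m a b \<and>
    conj_transpose Y * X = 0\<^sub>m b a \<and> conj_transpose Y * Y = 1\<^sub>m b"
    unfolding four_block_one_mat[symmetric]
    by (rule four_block_eq_iff) (use X Y in auto)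
  show ?thesis
    unfolding unitary_mat_def 1 2 3 using X Y append_cols_carrier[OF X Y] by auto
qed

lemma unitary_swap_cols:
  fixes X Y :: "'a :: star_ring mat"
  assumes "X \<in> carrier_mat (a + b) a" "Y \<in> carrier_mat (a + b) b" "unitary_mat (a + b) (X @\<^sub>c Y)"
  shows "unitary_mat (a + b) (Y @\<^sub>c X)"
proof -
  have "X * conj_transpose X + Y * conj_transpose Y = Y * conj_transpose Y + X * conj_transpose X"
    using assms by (intro comm_add_mat[of _ "a + b" "a + b"]) auto
  then show ?thesis
    using assms unitary_append_cols_iff[of X a b Y] unitary_append_cols_iff[of Y b a X]
    by (simp add: add.commute)
qed

section \<open>Completing a unit column to a unitary matrix\<close>

lemma inner_col:
  assumes "v \<in> carrier_mat n 1" "w \<in> carrier_mat n 1"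
  shows "(conj_transpose v * w) = mat 1 1 (\<lambda>_. \<Sum>k<n. conjugate (v $$ (k, 0)) * w $$ (k, 0))"
  using assms by (intro eq_matI) (auto simp: mat_entry_mult simp del: index_mult_mat(1))

text \<open>The condition on the length of \<open>x\<close> is the one under which the quadratic term of
  \<open>(I - x c x\<^sup>*)\<^sup>* (I - x c x\<^sup>*)\<close> cancels the linear ones: with \<open>b = c\<^sup>-\<^sup>1\<close>,
  \<open>c\<^sup>* (b + b\<^sup>*) c = c\<^sup>* + c\<close>.\<close>

lemma householder_unitary:
  fixes x :: "nat \<Rightarrow> 'a :: star_ring"
  assumes c: "c * b = 1" "b * c = 1"
    and w: "(\<Sum>k<n. conjugate (x k) * x k) = b + conjugate b"
  shows "unitary_mat n (mat n n (\<lambda>(i, j). (if i = j then 1 else 0) - x i * c * conjugate (x j)))"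
proof -
  let ?H = "\<lambda>c. mat n n (\<lambda>(i, j). (if i = j then 1 else 0) - x i * c * conjugate (x j))"
  have adj: "conj_transpose (?H c) = ?H (conjugate c)"
    by (rule eq_matI) (auto simp: star_diff star_mult mult.assoc)
  have c': "conjugate c * conjugate b = 1" "conjugate b * conjugate c = 1"
    using c by (simp_all flip: star_mult)
  have prod: "?H d * ?H e = 1\<^sub>m n" if de: "d * (b + conjugate b) * e = d + e" for d e
  proof (rule eq_matI)
    fix i j assume ij: "i < dim_row (1\<^sub>m n :: 'a mat)" "j < dim_col (1\<^sub>m n :: 'a mat)"
    let ?\<delta> = "\<lambda>i j :: nat. if i = j then 1 else (0 :: 'a)"
    have "(?H d * ?H e) $$ (i, j) =
      (\<Sum>k<n. (?\<delta> i k - x i * d * conjugate (x k)) * (?\<delta> k j - x k * e * conjugate (x j)))"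
      using ij by (simp add: mat_entry_mult del: index_mult_mat(1))
    also have "\<dots> = (\<Sum>k<n. ?\<delta> i k * ?\<delta> k j) - (\<Sum>k<n. ?\<delta> i k * (x k * e * conjugate (x j)))
        - (\<Sum>k<n. (x i * d * conjugate (x k)) * ?\<delta> k j)
        + (\<Sum>k<n. x i * d * (conjugate (x k) * x k) * (e * conjugate (x j)))"
      unfolding sum_subtractf[symmetric] sum.distrib[symmetric]
      by (intro sum.cong) (auto simp: algebra_simps)
    also have "(\<Sum>k<n. x i * d * (conjugate (x k) * x k) * (e * conjugate (x j)))
        = x i * d * (\<Sum>k<n. conjugate (x k) * x k) * (e * conjugate (x j))"
      by (simp only: sum_distrib_left sum_distrib_right)
    also have "\<dots> = x i * (d * (b + conjugate b) * e) * conjugate (x j)"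
      unfolding w by (simp only: mult.assoc)
    also have "\<dots> = x i * d * conjugate (x j) + x i * e * conjugate (x j)"
      unfolding de by (simp add: algebra_simps)
    also have "(\<Sum>k<n. ?\<delta> i k * ?\<delta> k j) = ?\<delta> i j"
      using ij by (simp add: if_distrib[of "\<lambda>x. x * _"] sum.delta cong: if_cong)
    also have "(\<Sum>k<n. ?\<delta> i k * (x k * e * conjugate (x j))) = x i * e * conjugate (x j)"
      using ij by (simp add: if_distrib[of "\<lambda>x. x * _"] sum.delta cong: if_cong)
    also have "(\<Sum>k<n. (x i * d * conjugate (x k)) * ?\<delta> k j) = x i * d * conjugate (x j)"
      using ij by (simp add: if_distrib[of "\<lambda>x. _ * x"] sum.delta cong: if_cong)
    finally show "(?H d * ?H e) $$ (i, j) = 1\<^sub>m n $$ (i, j)"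
      using ij by simp
  qed auto
  have "conjugate c * (b + conjugate b) * c = conjugate c + c"
    "c * (b + conjugate b) * conjugate c = c + conjugate c"
    using c c' by (simp_all add: algebra_simps)
  then show ?thesis
    unfolding unitary_mat_def adj using prod by auto
qed

text \<open>The reflection \<open>I - w c w\<^sup>*\<close> with \<open>w = v - e\<^sub>1\<close> maps \<open>e\<^sub>1\<close> to the unit column \<open>v\<close> when
  \<open>c = (1 - v\<^sub>1\<^sup>*)\<^sup>-\<^sup>1\<close>. For a real \<open>c\<close>, as in the reflections of Householder, \<open>v\<^sub>1\<close>
  would first have to be rotated to a real number. This \<open>c\<close> works for every
  \<open>v\<close> with \<open>1 - v\<^sub>1\<close> invertible; otherwise \<open>1 + v\<^sub>1\<close> is invertible and \<open>v\<close> may be replaced by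
  \<open>-v\<close>.\<close>

lemma unitary_first_col:
  fixes v :: "'a :: star_local_ring mat"
  assumes v: "v \<in> carrier_mat n 1" "conj_transpose v * v = 1\<^sub>m 1" and n: "n > 0"
  shows "\<exists>H. unitary_mat n H \<and> (\<forall>i<n. H $$ (i, 0) = v $$ (i, 0))"
proof -
  have main: "\<exists>H. unitary_mat n H \<and> (\<forall>i<n. H $$ (i, 0) = y i)"
    if y: "(\<Sum>k<n. conjugate (y k) * y k) = 1" and inv: "(1 - y 0) * z = 1" "z * (1 - y 0) = 1"
    for y :: "nat \<Rightarrow> 'a" and z
  proof -
    define x where "x k = y k - (if k = 0 then 1 else 0)" for k
    define b where "b = 1 - conjugate (y 0)"
    define c where "c = conjugate z"
    have c: "c * b = 1" "b * c = 1"
      using inv[THEN arg_cong[where f = conjugate]]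
      by (simp_all add: c_def b_def star_mult star_diff)
    have "(\<Sum>k<n. conjugate (x k) * x k) = (\<Sum>k<n. conjugate (y k) * y k
        + (if k = 0 then 1 - conjugate (y k) - y k else 0))"
      by (intro sum.cong) (auto simp: x_def star_diff algebra_simps)
    also have "\<dots> = b + conjugate b"
      using n by (simp add: sum.distrib y b_def star_diff)
    finally have "unitary_mat n (mat n n (\<lambda>(i, j). (if i = j then 1 else 0) - x i * c * conjugate (x j)))"
      by (rule householder_unitary[OF c])
    moreover have "(if i = 0 then 1 else 0) - x i * c * conjugate (x 0) = y i" for i
    proof -
      have "conjugate (x 0) = - b" by (simp add: x_def b_def star_diff)
      then show ?thesis using c by (simp add: mult.assoc x_def)
    qed
    ultimately show ?thesis using n by (intro exI conjI) auto
  qed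
  define y where "y k = v $$ (k, 0)" for k
  have y: "(\<Sum>k<n. conjugate (y k) * y k) = 1"
    using arg_cong[OF v(2), of "\<lambda>M. M $$ (0, 0)"] v(1) unfolding inner_col[OF v(1) v(1)] by (simp add: y_def)
  consider z where "(1 - y 0) * z = 1" "z * (1 - y 0) = 1"
    | z where "(1 + y 0) * z = 1" "z * (1 + y 0) = 1"
    using one_minus_or_one_plus_unit by blast
  then show ?thesis
  proof cases
    case 1
    from main[OF y 1] show ?thesis by (simp add: y_def)
  next
    case 2
    have "\<exists>H. unitary_mat n H \<and> (\<forall>i<n. H $$ (i, 0) = - y i)"
      by (rule main[of "\<lambda>i. - y i" z]) (use y 2 in \<open>simp_all add: star_uminus\<close>)
    then obtain H where H: "unitary_mat n H" "\<forall>i<n. H $$ (i, 0) = - y i" by blast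
    have "conj_transpose (- H) * (- H) = conj_transpose H * H"
      "(- H) * conj_transpose (- H) = H * conj_transpose H"
      using unitary_matD(1-3)[OF H(1)]
      by (auto intro!: eq_matI simp: mat_entry_mult star_uminus sum_negf simp del: index_mult_mat(1))
    then have "unitary_mat n (- H)"
      using H(1) by (simp add: unitary_mat_def)
    moreover have "\<forall>i<n. (- H) $$ (i, 0) = v $$ (i, 0)"
      using H(2) unitary_matD(1-3)[OF H(1)] n by (auto simp: y_def)
    ultimately show ?thesis by blast
  qed
qed

lemma unitary_extend_col:
  fixes v :: "'a :: star_local_ring mat"
  assumes v: "v \<in> carrier_mat (Suc n) 1" "conj_transpose v * v = 1\<^sub>m 1"
  obtains Y where "Y \<in> carrier_mat (Suc n) n" "unitary_mat (Suc n) (v @\<^sub>c Y)"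
proof -
  obtain H where H: "unitary_mat (Suc n) H" "\<forall>i<Suc n. H $$ (i, 0) = v $$ (i, 0)"
    using unitary_first_col[OF v] by auto
  obtain X Y where XY: "X \<in> carrier_mat (Suc n) 1" "Y \<in> carrier_mat (Suc n) n" "H = X @\<^sub>c Y"
    using split_cols[of H "Suc n" 1 n] unitary_matD(1)[OF H(1)] by auto
  have "X = v"
    using v(1) XY(1,2) H(2) unfolding XY(3) by (intro eq_matI) (auto simp: append_cols_entry)
  then show ?thesis using that XY H(1) by blast
qed

section \<open>Splitting off an eigenvector or a singular pair\<close>

text \<open>If \<open>A\<close> maps \<open>v\<close> to \<open>u \<mu>\<close> and its adjoint maps \<open>u\<close> to \<open>v \<mu>\<close>, then in bases that begin with
  \<open>u\<close> and \<open>v\<close> the matrix \<open>A\<close> is block diagonal.\<close>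

lemma deflate:
  fixes A :: "'a :: star_ring mat"
  assumes A: "A \<in> carrier_mat (Suc m) (Suc n)"
    and u: "u \<in> carrier_mat (Suc m) 1" and X: "X \<in> carrier_mat (Suc m) m"
    and v: "v \<in> carrier_mat (Suc n) 1" and Y: "Y \<in> carrier_mat (Suc n) n"
    and U: "unitary_mat (Suc m) (u @\<^sub>c X)" and V: "unitary_mat (Suc n) (v @\<^sub>c Y)"
    and M: "M \<in> carrier_mat 1 1"
    and Av: "A * v = u * M" and Au: "conj_transpose u * A = M * conj_transpose v"
  shows "conj_transpose (u @\<^sub>c X) * A * (v @\<^sub>c Y) =
    four_block_mat M (0\<^sub>m 1 n) (0\<^sub>m m 1) (conj_transpose X * A * Y)"
proof -
  have Ou: "conj_transpose u * u = 1\<^sub>m 1" "conj_transpose X * u = 0\<^sub>m m 1"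
    and Ov: "conj_transpose v * Y = 0\<^sub>m 1 n"
    using unitary_append_cols_iff[of u 1 m X] unitary_append_cols_iff[of v 1 n Y] u X v Y U V by auto
  have "conj_transpose (u @\<^sub>c X) * A * (v @\<^sub>c Y) =
    (conj_transpose u * A @\<^sub>r conj_transpose X * A) * (v @\<^sub>c Y)"
    using A u X by (simp add: conj_transpose_append_cols append_rows_mult)
  also have "\<dots> = four_block_mat (conj_transpose u * A * v) (conj_transpose u * A * Y)
      (conj_transpose X * A * v) (conj_transpose X * A * Y)"
    using A u X v Y by (intro append_rows_mult_append_cols[of _ 1 "Suc n" _ m _ 1 _ n]) auto
  finally have "conj_transpose (u @\<^sub>c X) * A * (v @\<^sub>c Y) = \<dots>" .
  moreover have "conj_transpose u * A * v = conj_transpose u * u * M"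
    "conj_transpose X * A * v = conj_transpose X * u * M"
    using A u X v M by (simp_all add: mat_mult_assoc Av)
  moreover have "conj_transpose u * A * Y = M * (conj_transpose v * Y)"
    unfolding Au using v Y M by (simp add: mat_mult_assoc)
  ultimately show ?thesis
    using Ou Ov M by simp
qed

section \<open>Eigenvectors of Hermitian quaternion matrices\<close>

text \<open>Four consecutive real coordinates make up one quaternion, so that the unit sphere can be seen as
  a closed subset of a product of intervals, which is compact.\<close>

definition qvec :: "(nat \<Rightarrow> real) \<Rightarrow> nat \<Rightarrow> quat" where
  "qvec x a = Quat (x (4 * a)) (x (4 * a + 1)) (x (4 * a + 2)) (x (4 * a + 3))"

lemma qvec_surj: "\<exists>x. qvec x = v"
proof -
  let ?x = "\<lambda>i. if i mod 4 = 0 then qre (v (i div 4)) else if i mod 4 = 1 then qi (v (i div 4))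
    else if i mod 4 = 2 then qj (v (i div 4)) else qk (v (i div 4))"
  have "qvec ?x a = v a" for a
  proof -
    have "Suc (4 * a) div 4 = a" "Suc (Suc (4 * a)) div 4 = a" "Suc (Suc (4 * a)) mod 4 = 2"
      by presburger+
    then show ?thesis by (simp add: qvec_def quat_eq_iff)
  qed
  then show ?thesis by blast
qed

definition qinner :: "nat set \<Rightarrow> (nat \<Rightarrow> quat) \<Rightarrow> (nat \<Rightarrow> quat) \<Rightarrow> real" where
  "qinner E u v = (\<Sum>a\<in>E. qre (conjugate (u a) * v a))"

lemma qre_sum: "qre (sum f X) = (\<Sum>x\<in>X. qre (f x))"
  by (induct X rule: infinite_finite_induct) (auto simp: plus_quat_def zero_quat_def)

lemma qre_zero [simp]: "qre 0 = 0"
  by (simp add: zero_quat_def)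

lemma qre_conjugate [simp]: "qre (conjugate x) = qre x"
  by (simp add: conjugate_quat_def)

lemma qinner_commute: "qinner E u v = qinner E v u"
  unfolding qinner_def by (intro sum.cong) (auto simp: quat_defs algebra_simps)

lemma qinner_add: "qinner E u (\<lambda>a. v a + t *\<^sub>R w a) = qinner E u v + t * qinner E u w"
  unfolding qinner_def sum_distrib_left sum.distrib[symmetric]
  by (intro sum.cong) (auto simp: quat_defs algebra_simps)

lemma qinner_add_left: "qinner E (\<lambda>a. v a + t *\<^sub>R w a) u = qinner E v u + t * qinner E w u"
  using qinner_add[of E u v t w] by (simp add: qinner_commute)

lemma qinner_self: "qinner E v v = (\<Sum>a\<in>E. qnorm2 (v a))"
  unfolding qinner_def by (intro sum.cong) (auto simp: quat_defs qnorm2_def power2_eq_square)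

text \<open>The first-order condition at a maximum, for a function that is quadratic along a line.\<close>

lemma linear_part_zero_if_nonpos:
  assumes "\<And>t::real. 2 * t * \<beta> + t\<^sup>2 * \<gamma> \<le> 0"
  shows "\<beta> = 0"
proof (rule ccontr)
  assume "\<beta> \<noteq> 0"
  define g where "g = \<bar>\<gamma>\<bar> + 1"
  have g: "g > 0" "2 * g + \<gamma> > 0" by (auto simp: g_def)
  have "2 * (\<beta> / g) * \<beta> + (\<beta> / g)\<^sup>2 * \<gamma> = \<beta>\<^sup>2 * (2 * g + \<gamma>) / g\<^sup>2"
    using g by (simp add: field_simps power2_eq_square)
  also have "\<dots> > 0"
    using g \<open>\<beta> \<noteq> 0\<close> by (intro divide_pos_pos mult_pos_pos) auto
  finally show False using assms[of "\<beta> / g"] by simp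
qed

text \<open>The Rayleigh quotient attains its maximum on the compact unit sphere, and at a maximum its
  derivative vanishes in every direction. Stating this for an arbitrary finite index set \<open>E\<close>
  covers the compression of a matrix to a coordinate subspace.\<close>

lemma quat_hermitian_eigenvector:
  fixes h :: "nat \<Rightarrow> nat \<Rightarrow> quat"
  assumes E: "finite E" "E \<noteq> {}"
    and h: "\<And>a b. a \<in> E \<Longrightarrow> b \<in> E \<Longrightarrow> conjugate (h a b) = h b a"
  obtains v \<mu> where "(\<Sum>a\<in>E. qnorm2 (v a)) = 1"
    "\<And>a. a \<in> E \<Longrightarrow> (\<Sum>b\<in>E. h a b * v b) = \<mu> *\<^sub>R v a" "\<And>a. a \<notin> E \<Longrightarrow> v a = 0"
proof -
  define H where "H v a = (\<Sum>b\<in>E. h a b * v b)" for v and a :: nat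
  have H_add: "H (\<lambda>a. v a + t *\<^sub>R w a) = (\<lambda>a. H v a + t *\<^sub>R H w a)" for v w t
    by (auto simp: H_def algebra_simps sum.distrib scaleR_sum_right)
  have "qinner E u (H v) = (\<Sum>a\<in>E. \<Sum>b\<in>E. qre (conjugate (u a) * h a b * v b))" for u v
    by (simp add: qinner_def H_def sum_distrib_left qre_sum mult.assoc)
  moreover have "(\<Sum>a\<in>E. \<Sum>b\<in>E. qre (conjugate (u a) * h a b * v b)) =
      (\<Sum>b\<in>E. \<Sum>a\<in>E. qre (conjugate (v b) * h b a * u a))" for u v
  proof -
    have "qre (conjugate (u a) * h a b * v b) = qre (conjugate (v b) * h b a * u a)"
      if "a \<in> E" "b \<in> E" for a b
      using qre_conjugate[of "conjugate (u a) * h a b * v b"] h[OF that]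
      by (simp add: star_mult mult.assoc)
    then show ?thesis by (subst sum.swap) simp
  qed
  ultimately have H_adj: "qinner E u (H v) = qinner E v (H u)" for u v
    by simp

  let ?box = "PiE UNIV (\<lambda>_::nat. {-1..1::real})"
  define K where "K = ?box \<inter> {x. qinner E (qvec x) (qvec x) = 1}"
  have "compactin (product_topology (\<lambda>_::nat. euclidean) UNIV) ?box"
    unfolding compactin_PiE by simp
  then have box: "compact ?box"
    by (simp add: euclidean_product_topology)
  have "continuous_on UNIV (\<lambda>x. qinner E (qvec x) (qvec x))"
    unfolding qinner_def
    by (intro continuous_on_sum) (simp add: quat_defs qvec_def, intro continuous_intros
        continuous_on_product_coordinates)
  then have "compact K"
    unfolding K_def
    by (intro compact_Int_closed[OF box] closed_Collect_eq) auto
  moreover have "K \<noteq> {}"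
  proof -
    obtain e where e: "e \<in> E" using E by blast
    let ?x = "\<lambda>i. if i = 4 * e then 1 else 0 :: real"
    have "qnorm2 (qvec ?x a) = (if a = e then 1 else 0)" for a
      by (auto simp: qvec_def qnorm2_def)
    then have "?x \<in> K"
      using e E by (simp add: K_def qinner_self PiE_def extensional_def)
    then show ?thesis by blast
  qed
  moreover have "continuous_on K (\<lambda>x. qinner E (qvec x) (H (qvec x)))"
    unfolding qinner_def H_def sum_distrib_left qre_sum
    by (intro continuous_on_sum) (simp add: quat_defs qvec_def, intro continuous_intros
        continuous_on_subset[OF continuous_on_product_coordinates] subset_UNIV)
  ultimately obtain x where x: "x \<in> K"
    and max: "\<And>y. y \<in> K \<Longrightarrow> qinner E (qvec y) (H (qvec y)) \<le> qinner E (qvec x) (H (qvec x))"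
    using continuous_attains_sup[of K "\<lambda>x. qinner E (qvec x) (H (qvec x))"] by blast
  define v where "v = qvec x"
  define \<mu> where "\<mu> = qinner E v (H v)"
  have v1: "qinner E v v = 1" using x by (simp add: K_def v_def)

  have bound_unit: "qinner E w (H w) \<le> \<mu>" if w: "qinner E w w = 1" for w
  proof -
    define w' where "w' a = (if a \<in> E then w a else 0)" for a
    obtain y where y: "qvec y = w'" using qvec_surj by blast
    have w'1: "qinner E w' w' = 1" using w by (simp add: qinner_def w'_def)
    have comp: "\<bar>qre (w' a)\<bar> \<le> 1 \<and> \<bar>qi (w' a)\<bar> \<le> 1 \<and> \<bar>qj (w' a)\<bar> \<le> 1 \<and> \<bar>qk (w' a)\<bar> \<le> 1" for a
    proof (cases "a \<in> E")
      case True
      have "qnorm2 (w' a) \<le> (\<Sum>a\<in>E. qnorm2 (w' a))"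
        using E True by (intro member_le_sum) auto
      then have "qnorm2 (w' a) \<le> 1" using w'1 by (simp add: qinner_self)
      then have "(qre (w' a))\<^sup>2 \<le> 1" "(qi (w' a))\<^sup>2 \<le> 1" "(qj (w' a))\<^sup>2 \<le> 1" "(qk (w' a))\<^sup>2 \<le> 1"
        unfolding qnorm2_def
        using zero_le_power2[of "qre (w' a)"] zero_le_power2[of "qi (w' a)"]
          zero_le_power2[of "qj (w' a)"] zero_le_power2[of "qk (w' a)"] by linarith+
      then show ?thesis by (simp add: abs_square_le_1)
    qed (simp add: w'_def zero_quat_def)
    have "\<bar>y i\<bar> \<le> 1" for i
    proof -
      have "i = 4 * (i div 4) + i mod 4" by simp
      moreover have "i mod 4 < 4" by simp
      then have "i mod 4 \<in> {0, 1, 2, 3}" by auto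
      ultimately have "i \<in> {4 * (i div 4), 4 * (i div 4) + 1, 4 * (i div 4) + 2, 4 * (i div 4) + 3}"
        by (metis add.right_neutral insert_iff empty_iff)
      then show ?thesis
        using comp[of "i div 4"] unfolding y[symmetric] qvec_def by auto
    qed
    then have "\<forall>i. y i \<in> {-1..1}" by (auto simp: abs_le_iff minus_le_iff)
    then have "y \<in> K"
      using w'1 by (auto simp: K_def y PiE_def)
    from max[OF this] have "qinner E w' (H w') \<le> \<mu>"
      by (simp add: y \<mu>_def v_def)
    moreover have "qinner E w' (H w') = qinner E w (H w)"
      by (simp add: qinner_def H_def w'_def)
    ultimately show ?thesis by simp
  qed
  have bound: "qinner E w (H w) \<le> \<mu> * qinner E w w" for w
  proof (cases "qinner E w w = 0")
    case True
    then have "\<forall>a\<in>E. w a = 0"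
      using E by (simp add: qinner_self sum_nonneg_eq_0_iff)
    then have "qinner E w (H w) = 0" by (simp add: qinner_def)
    then show ?thesis using True by simp
  next
    case False
    have "qinner E w w \<ge> 0" by (simp add: qinner_self sum_nonneg)
    define s where "s = 1 / sqrt (qinner E w w)"
    have s: "s\<^sup>2 * qinner E w w = 1" "s \<noteq> 0"
      using False \<open>qinner E w w \<ge> 0\<close> by (simp_all add: s_def power_divide)
    have zero: "H (\<lambda>_. 0) = (\<lambda>_. 0)" "qinner E (\<lambda>_. 0) u = 0" "qinner E u (\<lambda>_. 0) = 0" for u
      by (simp_all add: fun_eq_iff H_def qinner_def)
    have sc: "H (\<lambda>a. s *\<^sub>R w a) = (\<lambda>a. s *\<^sub>R H w a)"
      "qinner E (\<lambda>a. s *\<^sub>R w a) (\<lambda>a. s *\<^sub>R u a) = s\<^sup>2 * qinner E w u" for u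
      using H_add[of "\<lambda>_. 0" s w] qinner_add[of E "\<lambda>a. s *\<^sub>R w a" "\<lambda>_. 0" s u]
        qinner_add_left[of E "\<lambda>_. 0" s w u]
      by (simp_all only: zero add_0_left power2_eq_square mult.assoc)
    have "s\<^sup>2 * qinner E w (H w) \<le> \<mu>"
      using bound_unit[of "\<lambda>a. s *\<^sub>R w a"] s by (simp add: sc)
    also have "\<mu> = s\<^sup>2 * (\<mu> * qinner E w w)" using s by simp
    finally show ?thesis using s by (simp add: mult_le_cancel_left)
  qed
  have crit: "qinner E w (H v) = \<mu> * qinner E w v" for w
  proof -
    have "2 * t * (qinner E w (H v) - \<mu> * qinner E w v)
        + t\<^sup>2 * (qinner E w (H w) - \<mu> * qinner E w w) \<le> 0" for t
    proof -
      have "qinner E v (H w) = qinner E w (H v)" "qinner E v w = qinner E w v"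
        by (rule H_adj, rule qinner_commute)
      then show ?thesis
        using bound[of "\<lambda>a. v a + t *\<^sub>R w a"] v1 \<mu>_def
        by (simp add: H_add qinner_add qinner_add_left algebra_simps power2_eq_square)
    qed
    from linear_part_zero_if_nonpos[OF this] show ?thesis by simp
  qed
  have "qinner E (\<lambda>a. H v a + (- \<mu>) *\<^sub>R v a) (\<lambda>a. H v a + (- \<mu>) *\<^sub>R v a) = 0"
    by (subst qinner_add) (simp add: crit)
  then have eig: "\<forall>a\<in>E. H v a + (- \<mu>) *\<^sub>R v a = 0"
    using E unfolding qinner_self by (subst (asm) sum_nonneg_eq_0_iff) auto
  define v' where "v' a = (if a \<in> E then v a else 0)" for a
  show ?thesis
  proof (rule that[of v' \<mu>])
    show "(\<Sum>a\<in>E. qnorm2 (v' a)) = 1"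
      using v1 by (simp add: qinner_self v'_def)
    show "(\<Sum>b\<in>E. h a b * v' b) = \<mu> *\<^sub>R v' a" if "a \<in> E" for a
      using eig that by (simp add: H_def v'_def)
  qed (simp add: v'_def)
qed

section \<open>The quaternion spectral theorem\<close>

lemma conj_block_diag_mult:
  fixes A D :: "'a :: star_ring mat"
  assumes "U1 \<in> carrier_mat a a" "U2 \<in> carrier_mat b b" "V1 \<in> carrier_mat c c" "V2 \<in> carrier_mat d d"
    "A \<in> carrier_mat a c" "D \<in> carrier_mat b d"
  shows "conj_transpose (four_block_mat U1 (0\<^sub>m a b) (0\<^sub>m b a) U2) *
      four_block_mat A (0\<^sub>m a d) (0\<^sub>m b c) D * four_block_mat V1 (0\<^sub>m c d) (0\<^sub>m d c) V2 =
    four_block_mat (conj_transpose U1 * A * V1) (0\<^sub>m a d) (0\<^sub>m b c) (conj_transpose U2 * D * V2)"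
proof -
  have carrier: "conj_transpose U1 * A \<in> carrier_mat a c" "conj_transpose U2 * D \<in> carrier_mat b d"
    "conj_transpose U1 * A * V1 \<in> carrier_mat a c" "conj_transpose U2 * D * V2 \<in> carrier_mat b d"
    using assms by auto
  have "conj_transpose (four_block_mat U1 (0\<^sub>m a b) (0\<^sub>m b a) U2) *
      four_block_mat A (0\<^sub>m a d) (0\<^sub>m b c) D =
    four_block_mat (conj_transpose U1 * A) (0\<^sub>m a d) (0\<^sub>m b c) (conj_transpose U2 * D)"
    using assms carrier by (simp add: conj_transpose_four_block[of U1 a a _ b _ b]
        mult_four_block_mat[of _ a a _ b _ b _ _ c _ d])
  then show ?thesis
    using assms carrier by (simp add: mult_four_block_mat[of _ a c _ d _ b _ _ c _ d])
qed

lemma conj_transpose_mult_mult: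
  fixes A :: "'a :: star_ring mat"
  assumes "U \<in> carrier_mat m m" "W \<in> carrier_mat m m" "V \<in> carrier_mat n n" "Z \<in> carrier_mat n n"
    "A \<in> carrier_mat m n"
  shows "conj_transpose (U * W) * A * (V * Z) = conj_transpose W * (conj_transpose U * A * V) * Z"
  using assms by (simp add: conj_transpose_mult mat_mult_assoc)

lemma unitary_solve:
  fixes A :: "'a :: star_ring mat"
  assumes U: "unitary_mat m U" and V: "unitary_mat n V" and A: "A \<in> carrier_mat m n"
    and eq: "conj_transpose U * A * V = S"
  shows "A = U * S * conj_transpose V"
proof -
  have "U * S * conj_transpose V = U * (conj_transpose U * (A * (V * conj_transpose V)))"
    unfolding eq[symmetric] using unitary_matD(2,3)[OF U] unitary_matD(2,3)[OF V] A
    by (simp add: mat_mult_assoc)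
  also have "\<dots> = A"
    using unitary_matD(5)[OF V] A by (simp add: unitary_cancel[OF U])
  finally show ?thesis by simp
qed

lemma conjugate_of_real_quat [simp]: "conjugate (of_real x :: quat) = of_real x"
  by (simp add: of_real_def quat_defs)

lemma of_real_quat_commute: "of_real x * (y :: quat) = y * of_real x"
  by (simp add: of_real_def)

text \<open>An eigenvector is completed to a unitary matrix and split off; the remaining block is again
  Hermitian.\<close>

lemma quat_spectral:
  fixes H :: "quat mat"
  assumes "H \<in> carrier_mat n n" "conj_transpose H = H"
  shows "\<exists>U d. unitary_mat n U \<and> conj_transpose U * H * U = mat_diag n (\<lambda>a. of_real (d a))"
  using assms
proof (induct n arbitrary: H)
  case 0
  then have "conj_transpose (1\<^sub>m 0) * H * 1\<^sub>m 0 = mat_diag 0 (\<lambda>a. of_real (0 :: real))"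
    by (intro eq_matI) (auto simp: mat_diag_def)
  then show ?case
    by (intro exI[of _ "1\<^sub>m 0"] exI[of _ "\<lambda>_. 0"] conjI unitary_one)
next
  case (Suc n)
  have herm: "conjugate (H $$ (a, b)) = H $$ (b, a)" if "a < Suc n" "b < Suc n" for a b
    using arg_cong[OF Suc.prems(2), of "\<lambda>M. M $$ (b, a)"] Suc.prems(1) that by simp
  have ne: "{..<Suc n} \<noteq> {}" by (simp only: lessThan_empty_iff)
  obtain v \<mu> where v: "(\<Sum>a<Suc n. qnorm2 (v a)) = 1"
    "\<And>a. a < Suc n \<Longrightarrow> (\<Sum>b<Suc n. H $$ (a, b) * v b) = \<mu> *\<^sub>R v a"
    using quat_hermitian_eigenvector[OF finite_lessThan ne, of "\<lambda>a b. H $$ (a, b)"] herm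
    unfolding lessThan_iff by metis
  define y where "y = mat (Suc n) 1 (\<lambda>(a, _). v a)"
  define M where "M = mat 1 1 (\<lambda>_. of_real \<mu> :: quat)"
  have y: "y \<in> carrier_mat (Suc n) 1" and M: "M \<in> carrier_mat 1 1" "conj_transpose M = M"
    by (auto simp: y_def M_def)
  have "conj_transpose y * y = 1\<^sub>m 1"
    unfolding inner_col[OF y y]
    using v(1) by (intro eq_matI)
      (simp_all add: y_def conjugate_times_quat flip: of_real_sum of_real_add)
  then obtain Y where Y: "Y \<in> carrier_mat (Suc n) n" "unitary_mat (Suc n) (y @\<^sub>c Y)"
    using unitary_extend_col[OF y] by blast
  have Hy: "H * y = y * M"
    using Suc.prems(1) v(2)
    by (intro eq_matI) (auto simp: mat_entry_mult y_def M_def of_real_def simp del: index_mult_mat(1) sum.lessThan_Suc)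
  have yH: "conj_transpose y * H = M * conj_transpose y"
    using arg_cong[OF Hy, of conj_transpose] Suc.prems y M by (simp add: conj_transpose_mult)
  define H' where "H' = conj_transpose Y * H * Y"
  have "H' \<in> carrier_mat n n" "conj_transpose H' = H'"
    using Suc.prems Y by (auto simp: H'_def conj_transpose_mult mat_mult_assoc)
  from Suc.hyps[OF this] obtain U d where
    U: "unitary_mat n U" "conj_transpose U * H' * U = mat_diag n (\<lambda>a. of_real (d a))" by blast
  let ?B = "four_block_mat (1\<^sub>m 1) (0\<^sub>m 1 n) (0\<^sub>m n 1) U"
  have "conj_transpose ((y @\<^sub>c Y) * ?B) * H * ((y @\<^sub>c Y) * ?B) =
      conj_transpose ?B * (conj_transpose (y @\<^sub>c Y) * H * (y @\<^sub>c Y)) * ?B"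
    using unitary_matD(1)[OF U(1)] Suc.prems(1) unitary_matD(1)[OF Y(2)]
    by (intro conj_transpose_mult_mult) auto
  also have "\<dots> = conj_transpose ?B * four_block_mat M (0\<^sub>m 1 n) (0\<^sub>m n 1) H' * ?B"
    unfolding H'_def by (subst deflate[OF Suc.prems(1) y Y(1) y Y(1) Y(2) Y(2) M(1) Hy yH]) simp
  also have "\<dots> = four_block_mat M (0\<^sub>m 1 n) (0\<^sub>m n 1) (mat_diag n (\<lambda>a. of_real (d a)))"
    using M(1) \<open>H' \<in> carrier_mat n n\<close> unitary_matD(1)[OF U(1)] U(2)
    by (subst conj_block_diag_mult) auto
  also have "\<dots> = mat_diag (Suc n) (\<lambda>a. of_real ((case a of 0 \<Rightarrow> \<mu> | Suc a \<Rightarrow> d a)))"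
    by (intro eq_matI) (auto simp: mat_diag_def M_def split: nat.split)
  finally show ?case
    using unitary_mult[OF Y(2)] unitary_block_diag[OF unitary_one[of 1] U(1)] by auto
qed

section \<open>Eigenvectors of Hermitian dual quaternion matrices\<close>

abbreviation emb :: "'a :: zero \<Rightarrow> 'a dual" where
  "emb x \<equiv> Dual x 0"

lemma emb_mat_mult:
  fixes A B :: "'a :: ring_1 mat"
  assumes "dim_col A = dim_row B"
  shows "map_mat emb (A * B) = map_mat emb A * map_mat emb B"
  using assms by (intro eq_matI)
    (auto simp: mat_entry_mult dual_eq_iff dual_parts_sum simp del: index_mult_mat(1))

lemma std_mat_mult:
  fixes A B :: "'a :: ring_1 dual mat"
  assumes "dim_col A = dim_row B"
  shows "map_mat std_part (A * B) = map_mat std_part A * map_mat std_part B"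
  using assms by (intro eq_matI)
    (auto simp: mat_entry_mult dual_parts_sum simp del: index_mult_mat(1))

lemma conj_transpose_emb: 
  fixes A :: "'a :: star_ring mat"
  shows "conj_transpose (map_mat emb A) = map_mat emb (conj_transpose A)"
  by (intro eq_matI) (auto simp: conjugate_dual_def)

lemma conj_transpose_std:
  fixes A :: "'a :: conjugate dual mat"
  shows "conj_transpose (map_mat std_part A) = map_mat std_part (conj_transpose A)"
  by (intro eq_matI) (auto simp: conjugate_dual_def)

lemma std_emb_mat [simp]: "map_mat std_part (map_mat emb A) = A"
  by (intro eq_matI) auto

lemma unitary_emb:
  fixes U :: "'a :: star_ring mat"
  assumes "unitary_mat n U"
  shows "unitary_mat n (map_mat emb U)"
proof -
  have "map_mat emb (1\<^sub>m n :: 'a mat) = 1\<^sub>m n"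
    by (intro eq_matI) (auto simp: dual_eq_iff)
  then show ?thesis
    using unitary_matD[OF assms]
    by (simp add: unitary_mat_def conj_transpose_emb flip: emb_mat_mult)
qed

lemma dq_of_dual_parts [simp]:
  "std_part (dq_of_dual x) = of_real (std_part x)" "dual_part (dq_of_dual x) = of_real (dual_part x)"
  by (cases x; simp add: dq_of_dual_def)+

lemma dq_of_dual_simps [simp]:
  "dq_of_dual 0 = 0" "dq_of_dual 1 = 1"
  "conjugate (dq_of_dual x) = dq_of_dual x"
  by (simp_all add: dual_eq_iff)

lemma dq_of_dual_add: "dq_of_dual (x + y) = dq_of_dual x + dq_of_dual y"
  and dq_of_dual_mult: "dq_of_dual (x * y) = dq_of_dual x * dq_of_dual y"
  by (simp_all add: dual_eq_iff)

lemma dq_of_dual_diff: "dq_of_dual (x - y) = dq_of_dual x - dq_of_dual y"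
  by (simp add: dual_eq_iff)

lemma dq_of_dual_inject [simp]: "dq_of_dual x = dq_of_dual y \<longleftrightarrow> x = y"
  by (simp add: dual_eq_iff)

lemma dq_of_dual_commute: "dq_of_dual x * y = y * dq_of_dual x"
  by (simp add: dual_eq_iff of_real_quat_commute add.commute)

text \<open>A singular value or eigenvalue enters the matrix identities as a \<open>1 \<times> 1\<close> factor, on either side
  of a column or row, so that only associativity is needed to move it.\<close>

definition scalar_mat :: "dual_number \<Rightarrow> dual_quat mat" where
  "scalar_mat x = mat 1 1 (\<lambda>_. dq_of_dual x)"

lemma scalar_mat_carrier [simp]: "scalar_mat x \<in> carrier_mat 1 1"
  by (simp add: scalar_mat_def)

lemma scalar_mat_dim [simp]: "dim_row (scalar_mat x) = 1" "dim_col (scalar_mat x) = 1"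
  by (simp_all add: scalar_mat_def)

lemma scalar_mat_one: "scalar_mat 1 = 1\<^sub>m 1"
  by (intro eq_matI) (auto simp: scalar_mat_def)

lemma scalar_mat_mult: "scalar_mat x * scalar_mat y = scalar_mat (x * y)"
  by (intro eq_matI) (auto simp: mat_entry_mult scalar_mat_def dq_of_dual_mult simp del: index_mult_mat(1))

lemma conj_transpose_scalar_mat [simp]: "conj_transpose (scalar_mat x) = scalar_mat x"
  by (intro eq_matI) (auto simp: scalar_mat_def)

text \<open>First-order perturbation theory. In coordinates that diagonalise the standard part, let \<open>E\<close>
  index the eigenspace of a nonzero eigenvalue. The standard part of the eigenvector is an
  eigenvector, inside this eigenspace, of the compression of the dual part; its dual part is the
  usual first-order correction, with components outside \<open>E\<close> only, where the eigenvalue differences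
  can be inverted.\<close>

lemma dual_hermitian_eigenvector:
  fixes H :: "dual_quat mat"
  assumes H: "H \<in> carrier_mat n n" "conj_transpose H = H" and nz: "map_mat std_part H \<noteq> 0\<^sub>m n n"
  obtains v \<mu> where "v \<in> carrier_mat n 1" "conj_transpose v * v = 1\<^sub>m 1"
    "H * v = v * scalar_mat \<mu>" "std_part \<mu> \<noteq> 0"
proof -
  let ?H0 = "map_mat std_part H"
  have "conj_transpose ?H0 = ?H0"
    by (simp add: conj_transpose_std H(2))
  then obtain U d where U: "unitary_mat n U"
    and Ud: "conj_transpose U * ?H0 * U = mat_diag n (\<lambda>a. of_real (d a))"
    using quat_spectral[of ?H0 n] H(1) by auto
  have "\<exists>i<n. d i \<noteq> 0"
  proof (rule ccontr)
    assume "\<not> ?thesis"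
    then have "mat_diag n (\<lambda>a. of_real (d a)) = (0\<^sub>m n n :: quat mat)"
      by (intro eq_matI) (auto simp: mat_diag_def)
    then have "?H0 = U * 0\<^sub>m n n * conj_transpose U"
      using unitary_solve[OF U U _ Ud] H(1) by simp
    then show False using nz unitary_matD(1)[OF U] by simp
  qed
  then obtain i where i: "i < n" "d i \<noteq> 0" by blast
  define E where "E = {a. a < n \<and> d a = d i}"
  have E: "finite E" "E \<noteq> {}" "E \<subseteq> {..<n}" using i by (auto simp: E_def)
  define W where "W = map_mat emb U"
  have W: "unitary_mat n W" unfolding W_def by (rule unitary_emb[OF U])
  note Wc = unitary_matD(1-3)[OF W]
  define H' where "H' = conj_transpose W * H * W"
  have H': "H' \<in> carrier_mat n n" "conj_transpose H' = H'"
    using H Wc by (auto simp: H'_def conj_transpose_mult mat_mult_assoc)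
  have std_mat: "map_mat std_part H' = mat_diag n (\<lambda>a. of_real (d a))"
    using H(1) unitary_matD(1)[OF U]
    by (simp add: H'_def W_def std_mat_mult Ud flip: conj_transpose_std)
  have std: "std_part (H' $$ (a, b)) = (if a = b then of_real (d a) else 0)" if "a < n" "b < n" for a b
    using arg_cong[OF std_mat, of "\<lambda>M. M $$ (a, b)"] that H'(1) by (simp add: mat_diag_def)
  define K where "K a b = dual_part (H' $$ (a, b))" for a b
  have K: "conjugate (K a b) = K b a" if "a < n" "b < n" for a b
    using arg_cong[OF H'(2), of "\<lambda>M. dual_part (M $$ (b, a))"] H'(1) that by (simp add: K_def)
  \<comment> \<open>\<open>x\<close> is the standard part of the eigenvector, \<open>e\<close> the dual part of the eigenvalue.\<close>
  obtain x e where x: "(\<Sum>a\<in>E. qnorm2 (x a)) = 1"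
    "\<And>a. a \<in> E \<Longrightarrow> (\<Sum>b\<in>E. K a b * x b) = e *\<^sub>R x a" "\<And>a. a \<notin> E \<Longrightarrow> x a = 0"
    using quat_hermitian_eigenvector[OF E(1,2), of K] K E(3) by blast
  have x_sum: "(\<Sum>b\<in>E. K a b * x b) = (\<Sum>b<n. K a b * x b)"
    "(\<Sum>a\<in>E. qnorm2 (x a)) = (\<Sum>a<n. qnorm2 (x a))" for a
    using E x(3) by (intro sum.mono_neutral_left; auto)+
  \<comment> \<open>The dual part \<open>z\<close> solves \<open>d\<^sub>a z\<^sub>a + (K x)\<^sub>a = e x\<^sub>a + d\<^sub>i z\<^sub>a\<close> for \<open>a\<close> outside \<open>E\<close>, where \<open>x\<^sub>a = 0\<close>;
    inside \<open>E\<close> the equation holds by the choice of \<open>x\<close> and \<open>e\<close>, for every value of \<open>z\<^sub>a\<close>, and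
    \<open>z\<^sub>a = 0\<close> keeps the length equal to \<open>1\<close>.\<close>
  define z where "z a = (if a \<in> E then 0 else (1 / (d i - d a)) *\<^sub>R (\<Sum>b<n. K a b * x b))" for a
  define y where "y = mat n 1 (\<lambda>(a, _). Dual (x a) (z a))"
  define \<mu> where "\<mu> = Dual (d i) e"
  have y: "y \<in> carrier_mat n 1" by (simp add: y_def)
  have "conjugate (x a) * z a + conjugate (z a) * x a = 0" for a
    using x(3)[of a] by (cases "a \<in> E") (simp_all add: z_def)
  then have yy: "conj_transpose y * y = 1\<^sub>m 1"
    unfolding inner_col[OF y y] using x(1)
    by (intro eq_matI) (simp_all add: y_def dual_eq_iff dual_parts_sum conjugate_times_quat x_sum
        flip: of_real_sum)
  have H'y: "H' * y = y * scalar_mat \<mu>"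
  proof (rule eq_matI)
    fix a b assume "a < dim_row (y * scalar_mat \<mu>)" "b < dim_col (y * scalar_mat \<mu>)"
    then have ab: "a < n" "b = 0" by (simp_all add: y_def)
    have 1: "(H' * y) $$ (a, 0) = (\<Sum>k<n. H' $$ (a, k) * Dual (x k) (z k))"
      using ab H'(1) by (simp add: mat_entry_mult y_def del: index_mult_mat(1))
    have 2: "(y * scalar_mat \<mu>) $$ (a, 0) = Dual (x a) (z a) * dq_of_dual \<mu>"
      using ab by (simp add: mat_entry_mult y_def scalar_mat_def del: index_mult_mat(1))
    have "std_part (\<Sum>k<n. H' $$ (a, k) * Dual (x k) (z k)) = of_real (d a) * x a"
      using ab std by (simp add: dual_parts_sum if_distrib[of "\<lambda>u. u * _"] sum.delta cong: if_cong)
    moreover have "of_real (d a) * x a = x a * of_real (d i)"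
      using ab x(3)[of a] by (cases "a \<in> E") (auto simp: E_def of_real_quat_commute)
    moreover have "dual_part (\<Sum>k<n. H' $$ (a, k) * Dual (x k) (z k)) =
        of_real (d a) * z a + (\<Sum>k<n. K a k * x k)"
      using ab std by (simp add: dual_parts_sum if_distrib[of "\<lambda>u. u * _"] sum.delta sum.distrib
          K_def cong: if_cong)
    moreover have "\<dots> = x a * of_real e + z a * of_real (d i)"
    proof (cases "a \<in> E")
      case True
      then show ?thesis using x(2)[of a] by (simp add: z_def x_sum of_real_def)
    next
      case False
      then have "d i - d a \<noteq> 0" using ab by (auto simp: E_def)
      then have "(\<Sum>k<n. K a k * x k) = (d i - d a) *\<^sub>R z a"
        using False by (simp add: z_def)
      then show ?thesis using x(3)[OF False] by (simp add: of_real_def algebra_simps)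
    qed
    ultimately show "(H' * y) $$ (a, b) = (y * scalar_mat \<mu>) $$ (a, b)"
      unfolding ab(2) 1 2 by (simp add: dual_eq_iff \<mu>_def)
  qed (use H'(1) y in auto)
  show ?thesis
  proof (rule that[of "W * y" \<mu>])
    show "W * y \<in> carrier_mat n 1" using Wc y by simp
    show "conj_transpose (W * y) * (W * y) = 1\<^sub>m 1"
      using Wc y yy by (simp add: conj_transpose_mult mat_mult_assoc unitary_cancel[OF W])
    have "H * (W * y) = W * (H' * y)"
      using Wc y H(1) by (simp add: H'_def mat_mult_assoc unitary_cancel[OF W])
    then show "H * (W * y) = W * y * scalar_mat \<mu>"
      using Wc y by (simp add: H'y mat_mult_assoc)
    show "std_part \<mu> \<noteq> 0" using i by (simp add: \<mu>_def)
  qed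
qed

section \<open>Singular value decomposition\<close>

lemma less_dual_zero: "0 < (x :: dual_number) \<longleftrightarrow> 0 < std_part x \<or> std_part x = 0 \<and> 0 < dual_part x"
  by (auto simp: less_dual_def)

text \<open>The values of smooth functions at dual numbers are first-order Taylor expansions,
  \<open>f (a + b\<epsilon>) = f a + f' a b \<epsilon>\<close>.\<close>

definition dual_sqrt :: "dual_number \<Rightarrow> dual_number" where
  "dual_sqrt x = Dual (sqrt (std_part x)) (dual_part x / (2 * sqrt (std_part x)))"

lemma std_part_dual_sqrt [simp]: "std_part (dual_sqrt x) = sqrt (std_part x)"
  by (simp add: dual_sqrt_def)

lemma dual_sqrt_mult_self: "std_part x > 0 \<Longrightarrow> dual_sqrt x * dual_sqrt x = x"
  by (simp add: dual_sqrt_def dual_eq_iff)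

definition dual_inverse :: "dual_number \<Rightarrow> dual_number" where
  "dual_inverse x = Dual (1 / std_part x) (- dual_part x / (std_part x)\<^sup>2)"

lemma dual_inverse_mult: "std_part x \<noteq> 0 \<Longrightarrow> x * dual_inverse x = 1"
  by (simp add: dual_inverse_def dual_eq_iff power2_eq_square)

text \<open>A singular pair of \<open>A\<close> comes from an eigenvector \<open>v\<close> of \<open>A\<^sup>* A\<close> whose eigenvalue \<open>\<lambda>\<close> is
  appreciable: \<open>\<lambda>\<close> is then positive and has an invertible square root \<open>\<mu>\<close>, and \<open>u = A v / \<mu>\<close>.\<close>

lemma singular_pair_appreciable:
  fixes A :: "dual_quat mat"
  assumes A: "A \<in> carrier_mat m n" and nz: "map_mat std_part A \<noteq> 0\<^sub>m m n"
  obtains u v \<mu> where "u \<in> carrier_mat m 1" "v \<in> carrier_mat n 1" "std_part \<mu> > 0"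
    "conj_transpose u * u = 1\<^sub>m 1" "conj_transpose v * v = 1\<^sub>m 1"
    "A * v = u * scalar_mat \<mu>" "conj_transpose u * A = scalar_mat \<mu> * conj_transpose v"
proof -
  let ?H = "conj_transpose A * A"
  obtain i j where ij: "i < m" "j < n" "std_part (A $$ (i, j)) \<noteq> 0"
  proof (rule ccontr)
    assume "\<not> thesis"
    then have "map_mat std_part A = 0\<^sub>m m n"
      using A that by (intro eq_matI) auto
    then show False using nz by simp
  qed
  have H: "?H \<in> carrier_mat n n" "conj_transpose ?H = ?H"
    using A by (auto simp: conj_transpose_mult)
  have "std_part (?H $$ (j, j)) = of_real (\<Sum>k<m. qnorm2 (std_part (A $$ (k, j))))"
    using A ij by (simp add: mat_entry_mult dual_parts_sum conjugate_times_quat del: index_mult_mat(1))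
  moreover have "(\<Sum>k<m. qnorm2 (std_part (A $$ (k, j)))) \<noteq> 0"
    using ij by (subst sum_nonneg_eq_0_iff) auto
  ultimately have "std_part (?H $$ (j, j)) \<noteq> 0"
    by (simp del: of_real_sum)
  then have "map_mat std_part ?H $$ (j, j) \<noteq> 0"
    using ij A by (simp del: index_mult_mat(1))
  then have "map_mat std_part ?H \<noteq> 0\<^sub>m n n"
    using ij by auto
  then obtain v \<nu> where v: "v \<in> carrier_mat n 1" "conj_transpose v * v = 1\<^sub>m 1"
    "?H * v = v * scalar_mat \<nu>" "std_part \<nu> \<noteq> 0"
    using dual_hermitian_eigenvector[OF H] by blast
  define w where "w = A * v"
  have w: "w \<in> carrier_mat m 1" using A v by (simp add: w_def)
  have Aw: "conj_transpose A * w = v * scalar_mat \<nu>"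
    using v A by (simp add: w_def mat_mult_assoc)
  have wA: "conj_transpose w * A = scalar_mat \<nu> * conj_transpose v"
    using arg_cong[OF Aw, of conj_transpose] A w v by (simp add: conj_transpose_mult)
  have ww: "conj_transpose w * w = scalar_mat \<nu>"
  proof -
    have "conj_transpose w * w = (conj_transpose w * A) * v"
      using A w v by (simp add: w_def mat_mult_assoc)
    also have "\<dots> = scalar_mat \<nu> * (conj_transpose v * v)"
      unfolding wA using v by (simp add: mat_mult_assoc)
    finally show ?thesis using v(2) by simp
  qed
  have "of_real (std_part \<nu>) = (\<Sum>k<m. conjugate (std_part (w $$ (k, 0))) * std_part (w $$ (k, 0)))"
    using arg_cong[OF ww[unfolded inner_col[OF w w]], of "\<lambda>M. std_part (M $$ (0, 0))"]
    by (simp add: scalar_mat_def dual_parts_sum)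
  also have "\<dots> = of_real (\<Sum>k<m. qnorm2 (std_part (w $$ (k, 0))))"
    by (simp add: conjugate_times_quat)
  finally have "std_part \<nu> = (\<Sum>k<m. qnorm2 (std_part (w $$ (k, 0))))"
    by (simp only: of_real_eq_iff)
  then have "std_part \<nu> > 0"
    using v(4) by (simp add: less_le sum_nonneg)
  moreover define \<mu> where "\<mu> = dual_sqrt \<nu>"
  moreover define \<mu>' where "\<mu>' = dual_inverse \<mu>"
  ultimately have \<mu>: "\<mu> * \<mu> = \<nu>" "\<mu> * \<mu>' = 1" "std_part \<mu> > 0"
    by (simp_all add: dual_sqrt_mult_self dual_inverse_mult)
  let ?u = "w * scalar_mat \<mu>'"
  have u: "?u \<in> carrier_mat m 1" by (rule mult_carrier_mat[OF w scalar_mat_carrier])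
  have cu: "conj_transpose ?u = scalar_mat \<mu>' * conj_transpose w"
    using w by (simp add: conj_transpose_mult)
  have inv: "\<mu>' * \<nu> = \<mu>"
    using \<mu> by (metis mult.assoc mult.commute mult_1)
  show ?thesis
  proof (rule that[OF u v(1) \<mu>(3) _ v(2)])
    have "conj_transpose ?u * ?u = scalar_mat \<mu>' * (conj_transpose w * w) * scalar_mat \<mu>'"
      unfolding cu using w by (simp add: mat_mult_assoc)
    also have "\<dots> = 1\<^sub>m 1"
      unfolding ww using inv \<mu> by (simp add: scalar_mat_mult scalar_mat_one)
    finally show "conj_transpose ?u * ?u = 1\<^sub>m 1" .
    show "A * v = ?u * scalar_mat \<mu>"
      using w \<mu> by (simp add: mat_mult_assoc scalar_mat_mult scalar_mat_one mult.commute[of \<mu>'] flip: w_def)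
    show "conj_transpose ?u * A = scalar_mat \<mu> * conj_transpose v"
      unfolding cu using A w v wA inv
      by (simp add: mat_mult_assoc scalar_mat_mult flip: mat_mult_assoc[of "scalar_mat \<mu>'" "scalar_mat \<nu>"])
  qed
qed

text \<open>An infinitesimal matrix is \<open>\<epsilon>\<close> times one with the same singular vectors whose standard part is
  nonzero.\<close>

lemma singular_pair:
  fixes A :: "dual_quat mat"
  assumes A: "A \<in> carrier_mat m n" and nz: "A \<noteq> 0\<^sub>m m n"
  obtains u v \<mu> where "u \<in> carrier_mat m 1" "v \<in> carrier_mat n 1" "\<mu> > 0"
    "conj_transpose u * u = 1\<^sub>m 1" "conj_transpose v * v = 1\<^sub>m 1"
    "A * v = u * scalar_mat \<mu>" "conj_transpose u * A = scalar_mat \<mu> * conj_transpose v"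
proof (cases "map_mat std_part A = 0\<^sub>m m n")
  case False
  from singular_pair_appreciable[OF A this] that show ?thesis
    by (metis less_dual_zero)
next
  case True
  have std: "std_part (A $$ (a, b)) = 0" if "a < m" "b < n" for a b
    using arg_cong[OF True, of "\<lambda>M. M $$ (a, b)"] that A by simp
  define B where "B = map_mat (\<lambda>x. emb (dual_part x)) A"
  have B: "B \<in> carrier_mat m n" using A by (simp add: B_def)
  have AB: "A $$ (a, b) = dq_of_dual (Dual 0 1) * B $$ (a, b)" if "a < m" "b < n" for a b
    using that A std by (simp add: B_def dual_eq_iff)
  have "map_mat std_part B \<noteq> 0\<^sub>m m n"
  proof
    assume "map_mat std_part B = 0\<^sub>m m n"
    then have "map_mat std_part B $$ (a, b) = 0" if "a < m" "b < n" for a b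
      using that by simp
    then have "A = 0\<^sub>m m n"
      using A B std by (intro eq_matI) (auto simp: B_def dual_eq_iff)
    then show False using nz by simp
  qed
  then obtain u v \<mu> where u: "u \<in> carrier_mat m 1" and v: "v \<in> carrier_mat n 1"
    and \<mu>: "std_part \<mu> > 0"
    and unit: "conj_transpose u * u = 1\<^sub>m 1" "conj_transpose v * v = 1\<^sub>m 1"
    and Bv: "B * v = u * scalar_mat \<mu>" and uB: "conj_transpose u * B = scalar_mat \<mu> * conj_transpose v"
    using singular_pair_appreciable[OF B] by blast
  let ?e = "Dual 0 1 :: dual_number"
  show ?thesis
  proof (rule that[OF u v _ unit])
    show "?e * \<mu> > 0" using \<mu> by (simp add: less_dual_zero)
    show "A * v = u * scalar_mat (?e * \<mu>)"
    proof (rule eq_matI)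
      fix a b assume ab: "a < dim_row (u * scalar_mat (?e * \<mu>))" "b < dim_col (u * scalar_mat (?e * \<mu>))"
      then have "(A * v) $$ (a, b) = dq_of_dual ?e * (B * v) $$ (a, b)"
        using A B u v by (simp add: mat_entry_mult AB sum_distrib_left mult.assoc del: index_mult_mat(1))
      also have "\<dots> = (u * scalar_mat (?e * \<mu>)) $$ (a, b)"
        unfolding Bv using ab u
        by (simp add: mat_entry_mult scalar_mat_def dq_of_dual_mult dq_of_dual_commute[of ?e] mult.assoc
            del: index_mult_mat(1))
      finally show "(A * v) $$ (a, b) = (u * scalar_mat (?e * \<mu>)) $$ (a, b)" .
    qed (use A u v in auto)
    show "conj_transpose u * A = scalar_mat (?e * \<mu>) * conj_transpose v"
    proof (rule eq_matI)
      fix a b assume ab: "a < dim_row (scalar_mat (?e * \<mu>) * conj_transpose v)"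
        "b < dim_col (scalar_mat (?e * \<mu>) * conj_transpose v)"
      have "x * (dq_of_dual ?e * y) = dq_of_dual ?e * (x * y)" for x y
        by (metis dq_of_dual_commute mult.assoc)
      then have "(conj_transpose u * A) $$ (a, b) = dq_of_dual ?e * (conj_transpose u * B) $$ (a, b)"
        using A B u v ab by (simp add: mat_entry_mult AB sum_distrib_left del: index_mult_mat(1))
      also have "\<dots> = (scalar_mat (?e * \<mu>) * conj_transpose v) $$ (a, b)"
        unfolding uB using ab v
        by (simp add: mat_entry_mult scalar_mat_def dq_of_dual_mult mult.assoc del: index_mult_mat(1))
      finally show "(conj_transpose u * A) $$ (a, b) = (scalar_mat (?e * \<mu>) * conj_transpose v) $$ (a, b)" .
    qed (use A u v in auto)
  qed
qed

text \<open>Positions beyond the list are filled with \<open>0\<close>, so that sizes of zero blocks need not be tracked.\<close>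

definition rect_diag :: "nat \<Rightarrow> nat \<Rightarrow> dual_number list \<Rightarrow> dual_quat mat" where
  "rect_diag m n \<mu>s =
     mat m n (\<lambda>(a, b). if a = b \<and> a < length \<mu>s then dq_of_dual (\<mu>s ! a) else 0)"

lemma rect_diag_carrier [simp]: "rect_diag m n \<mu>s \<in> carrier_mat m n"
  by (simp add: rect_diag_def)

lemma rect_diag_four_block:
  assumes "length \<mu>s \<le> m" "length \<mu>s \<le> n"
  shows "rect_diag m n \<mu>s = four_block_mat (diag_of_list (map dq_of_dual \<mu>s))
    (0\<^sub>m (length \<mu>s) (n - length \<mu>s)) (0\<^sub>m (m - length \<mu>s) (length \<mu>s))
    (0\<^sub>m (m - length \<mu>s) (n - length \<mu>s))"
  using assms by (intro eq_matI) (auto simp: rect_diag_def diag_of_list_def mat_diag_def)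

text \<open>Singular pairs are split off one after the other, in no particular order, until the remaining
  block is \<open>0\<close>.\<close>

lemma unsorted_svd:
  fixes A :: "dual_quat mat"
  assumes "A \<in> carrier_mat m n"
  shows "\<exists>U V \<mu>s. unitary_mat m U \<and> unitary_mat n V \<and> length \<mu>s \<le> m \<and> length \<mu>s \<le> n \<and>
    (\<forall>\<mu>\<in>set \<mu>s. \<mu> > 0) \<and> conj_transpose U * A * V = rect_diag m n \<mu>s"
  using assms
proof (induct m arbitrary: n A)
  case 0
  then have "conj_transpose (1\<^sub>m 0) * A * 1\<^sub>m n = rect_diag 0 n []"
    by (intro eq_matI) (auto simp: rect_diag_def)
  then show ?case
    by (intro exI[of _ "1\<^sub>m 0"] exI[of _ "1\<^sub>m n"] exI[of _ "[]"] conjI) auto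
next
  case (Suc m n A)
  show ?case
  proof (cases "A = 0\<^sub>m (Suc m) n")
    case True
    then have "conj_transpose (1\<^sub>m (Suc m)) * A * 1\<^sub>m n = rect_diag (Suc m) n []"
      by (intro eq_matI) (auto simp: rect_diag_def)
    then show ?thesis
      by (intro exI[of _ "1\<^sub>m (Suc m)"] exI[of _ "1\<^sub>m n"] exI[of _ "[]"] conjI) auto
  next
    case False
    then have "n \<noteq> 0"
      using Suc.prems by (metis carrier_matD eq_matI index_zero_mat(2,3) less_nat_zero_code)
    then obtain n' where n: "n = Suc n'" by (cases n) auto
    note A = Suc.prems[unfolded n]
    obtain u v \<mu> where u: "u \<in> carrier_mat (Suc m) 1" and v: "v \<in> carrier_mat (Suc n') 1"
      and \<mu>: "\<mu> > 0" and unit: "conj_transpose u * u = 1\<^sub>m 1" "conj_transpose v * v = 1\<^sub>m 1"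
      and Av: "A * v = u * scalar_mat \<mu>" "conj_transpose u * A = scalar_mat \<mu> * conj_transpose v"
      using singular_pair[OF A] False unfolding n by blast
    obtain X where X: "X \<in> carrier_mat (Suc m) m" "unitary_mat (Suc m) (u @\<^sub>c X)"
      using unitary_extend_col[OF u unit(1)] by blast
    obtain Y where Y: "Y \<in> carrier_mat (Suc n') n'" "unitary_mat (Suc n') (v @\<^sub>c Y)"
      using unitary_extend_col[OF v unit(2)] by blast
    define A' where "A' = conj_transpose X * A * Y"
    have A': "A' \<in> carrier_mat m n'" using X Y A by (auto simp: A'_def)
    from Suc.hyps[OF this] obtain U V \<mu>s where U: "unitary_mat m U" and V: "unitary_mat n' V"
      and \<mu>s: "length \<mu>s \<le> m" "length \<mu>s \<le> n'" "\<forall>\<mu>\<in>set \<mu>s. \<mu> > 0"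
      and UAV: "conj_transpose U * A' * V = rect_diag m n' \<mu>s"
      by blast
    note Uc = unitary_matD(1)[OF U] and Vc = unitary_matD(1)[OF V]
    let ?U = "four_block_mat (1\<^sub>m 1) (0\<^sub>m 1 m) (0\<^sub>m m 1) U"
    let ?V = "four_block_mat (1\<^sub>m 1) (0\<^sub>m 1 n') (0\<^sub>m n' 1) V"
    have "conj_transpose ((u @\<^sub>c X) * ?U) * A * ((v @\<^sub>c Y) * ?V) =
        conj_transpose ?U * (conj_transpose (u @\<^sub>c X) * A * (v @\<^sub>c Y)) * ?V"
      using Uc Vc A unitary_matD(1)[OF X(2)] unitary_matD(1)[OF Y(2)]
      by (intro conj_transpose_mult_mult) auto
    also have "\<dots> = conj_transpose ?U * four_block_mat (scalar_mat \<mu>) (0\<^sub>m 1 n') (0\<^sub>m m 1) A' * ?V"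
      unfolding A'_def by (subst deflate[OF A u X(1) v Y(1) X(2) Y(2) scalar_mat_carrier Av]) simp
    also have "\<dots> = four_block_mat (scalar_mat \<mu>) (0\<^sub>m 1 n') (0\<^sub>m m 1) (rect_diag m n' \<mu>s)"
      using A' Uc Vc UAV by (subst conj_block_diag_mult) auto
    also have "\<dots> = rect_diag (Suc m) (Suc n') (\<mu> # \<mu>s)"
      by (intro eq_matI) (auto simp: rect_diag_def scalar_mat_def less_Suc_eq_0_disj split: if_splits)
    finally have eq: "conj_transpose ((u @\<^sub>c X) * ?U) * A * ((v @\<^sub>c Y) * ?V) =
      rect_diag (Suc m) (Suc n') (\<mu> # \<mu>s)" .
    have "unitary_mat (Suc m) ((u @\<^sub>c X) * ?U)" "unitary_mat (Suc n') ((v @\<^sub>c Y) * ?V)"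
      using unitary_mult[OF X(2)] unitary_mult[OF Y(2)]
        unitary_block_diag[OF unitary_one[of 1] U] unitary_block_diag[OF unitary_one[of 1] V] by auto
    then show ?thesis
      unfolding n using eq \<mu>s \<mu>
      by (intro exI[of _ "(u @\<^sub>c X) * ?U"] exI[of _ "(v @\<^sub>c Y) * ?V"] exI[of _ "\<mu> # \<mu>s"] conjI) auto
  qed
qed

lemma unitary_permute_cols:
  fixes U :: "'a :: star_ring mat"
  assumes U: "unitary_mat n U" and p: "p permutes {..<n}"
  shows "unitary_mat n (mat n n (\<lambda>(a, b). U $$ (a, p b)))"
proof -
  let ?U = "mat n n (\<lambda>(a, b). U $$ (a, p b))"
  note Uc = unitary_matD(1)[OF U]
  have pn: "p b < n" if "b < n" for b using permutes_in_image[OF p, of b] that by simp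
  have "conj_transpose ?U * ?U = 1\<^sub>m n"
  proof (rule eq_matI)
    fix a b assume ab: "a < dim_row (1\<^sub>m n :: 'a mat)" "b < dim_col (1\<^sub>m n :: 'a mat)"
    then have "(conj_transpose ?U * ?U) $$ (a, b) = (conj_transpose U * U) $$ (p a, p b)"
      using Uc pn by (simp add: mat_entry_mult del: index_mult_mat(1))
    also have "\<dots> = 1\<^sub>m n $$ (a, b)"
      unfolding unitary_matD(4)[OF U] using ab pn permutes_inj[OF p] by (simp add: inj_eq)
    finally show "(conj_transpose ?U * ?U) $$ (a, b) = 1\<^sub>m n $$ (a, b)" .
  qed auto
  moreover have "?U * conj_transpose ?U = U * conj_transpose U"
  proof (rule eq_matI)
    fix a b assume ab: "a < dim_row (U * conj_transpose U)" "b < dim_col (U * conj_transpose U)"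
    have "(?U * conj_transpose ?U) $$ (a, b) = (\<Sum>k<n. U $$ (a, p k) * conjugate (U $$ (b, p k)))"
      using ab Uc by (simp add: mat_entry_mult del: index_mult_mat(1))
    also have "\<dots> = (\<Sum>k<n. U $$ (a, k) * conjugate (U $$ (b, k)))"
      by (rule sum.permute[OF p, symmetric, unfolded comp_def])
    also have "\<dots> = (U * conj_transpose U) $$ (a, b)"
      using ab Uc by (simp add: mat_entry_mult del: index_mult_mat(1))
    finally show "(?U * conj_transpose ?U) $$ (a, b) = (U * conj_transpose U) $$ (a, b)" .
  qed (use Uc in auto)
  ultimately show ?thesis
    using unitary_matD(5)[OF U] by (simp add: unitary_mat_def)
qed

text \<open>The same permutation of the columns of both unitary factors sorts the singular values.\<close>

theorem dual_quat_svd: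
  fixes A :: "dual_quat mat"
  assumes A: "A \<in> carrier_mat m n"
  obtains U V \<mu>s where "unitary_mat m U" "unitary_mat n V" "length \<mu>s \<le> m" "length \<mu>s \<le> n"
    "sorted_wrt (\<ge>) \<mu>s" "\<forall>\<mu>\<in>set \<mu>s. \<mu> > 0" "conj_transpose U * A * V = rect_diag m n \<mu>s"
proof -
  obtain U V \<mu>s where U: "unitary_mat m U" and V: "unitary_mat n V"
    and len: "length \<mu>s \<le> m" "length \<mu>s \<le> n" and pos: "\<forall>\<mu>\<in>set \<mu>s. \<mu> > 0"
    and eq: "conj_transpose U * A * V = rect_diag m n \<mu>s"
    using unsorted_svd[OF A] by blast
  define \<nu>s where "\<nu>s = rev (sort \<mu>s)"
  have "mset \<nu>s = mset \<mu>s" by (simp add: \<nu>s_def)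
  then obtain p where p: "p permutes {..<length \<mu>s}" "permute_list p \<mu>s = \<nu>s"
    by (rule mset_eq_permutation)
  then have len': "length \<nu>s = length \<mu>s" by auto
  have pm: "p permutes {..<m}" "p permutes {..<n}"
    using permutes_subset[OF p(1)] len by auto
  note Uc = unitary_matD(1)[OF U] and Vc = unitary_matD(1)[OF V]
  let ?U = "mat m m (\<lambda>(a, b). U $$ (a, p b))" and ?V = "mat n n (\<lambda>(a, b). V $$ (a, p b))"
  have pl: "p a < k \<longleftrightarrow> a < k" if "p permutes {..<k}" for a k
    using permutes_in_image[OF that, of a] by simp
  have "conj_transpose ?U * A * ?V = rect_diag m n \<nu>s"
  proof (rule eq_matI)
    fix a b assume "a < dim_row (rect_diag m n \<nu>s)" "b < dim_col (rect_diag m n \<nu>s)"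
    then have ab: "a < m" "b < n" by (simp_all add: rect_diag_def)
    have "(conj_transpose ?U * A * ?V) $$ (a, b) = (conj_transpose U * A * V) $$ (p a, p b)"
      using ab A Uc Vc pl[OF pm(1)] pl[OF pm(2)] by (simp add: mat_entry_mult del: index_mult_mat(1))
    also have "\<dots> = rect_diag m n \<nu>s $$ (a, b)"
      unfolding eq using ab pl[OF pm(1)] pl[OF pm(2)] pl[OF p(1)] len'
      by (auto simp: rect_diag_def inj_eq[OF permutes_inj[OF p(1)]] p(2)[symmetric] permute_list_nth[OF p(1)])
    finally show "(conj_transpose ?U * A * ?V) $$ (a, b) = rect_diag m n \<nu>s $$ (a, b)" .
  qed (auto simp: rect_diag_def)
  moreover have "sorted_wrt (\<ge>) \<nu>s"
    by (simp add: \<nu>s_def sorted_wrt_rev)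
  ultimately show ?thesis
    using that[of ?U ?V \<nu>s] unitary_permute_cols[OF U pm(1)] unitary_permute_cols[OF V pm(2)] len len' pos
    by (simp add: \<nu>s_def)
qed

text \<open>The rank is defined by choosing a length that occurs in some decomposition; by existence of the
  decomposition the chosen length does occur.\<close>

lemma dual_quat_svd_rank:
  fixes A :: "dual_quat mat"
  assumes A: "A \<in> carrier_mat m n"
  obtains U V \<mu>s where "unitary_mat m U" "unitary_mat n V" "length \<mu>s = dq_rank A"
    "dq_rank A \<le> m" "dq_rank A \<le> n" "conj_transpose U * A * V = rect_diag m n \<mu>s"
proof -
  have iff: "dq_svd A U V \<mu>s \<longleftrightarrow> unitary_mat m U \<and> unitary_mat n V \<and> length \<mu>s \<le> m \<and> length \<mu>s \<le> n \<and>
     sorted_wrt (\<ge>) \<mu>s \<and> (\<forall>\<mu> \<in> set \<mu>s. \<mu> > 0) \<and> conj_transpose U * A * V = rect_diag m n \<mu>s" for U V \<mu>s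
    using A by (auto simp: dq_svd_def Let_def rect_diag_four_block)
  obtain U V \<mu>s where "dq_svd A U V \<mu>s"
    using dual_quat_svd[OF A] unfolding iff by metis
  then have "\<exists>t U V \<mu>s. dq_svd A U V \<mu>s \<and> length \<mu>s = t" by blast
  then have "\<exists>U V \<mu>s. dq_svd A U V \<mu>s \<and> length \<mu>s = dq_rank A"
    unfolding dq_rank_def by (rule someI_ex)
  then show ?thesis using that unfolding iff by metis
qed

section \<open>Triangularisation, unitary decomposition and completion\<close>

lemma mat_four_block_first_col:
  assumes "N \<in> carrier_mat (Suc p) (Suc n)" "\<And>a. 0 < a \<Longrightarrow> a < Suc p \<Longrightarrow> N $$ (a, 0) = (0 :: 'a :: zero)"
  obtains \<alpha> \<beta> N' where "\<alpha> \<in> carrier_mat 1 1" "\<beta> \<in> carrier_mat 1 n" "N' \<in> carrier_mat p n"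
    "N = four_block_mat \<alpha> \<beta> (0\<^sub>m p 1) N'"
proof
  let ?\<alpha> = "mat 1 1 (\<lambda>_. N $$ (0, 0))" and ?\<beta> = "mat 1 n (\<lambda>(_, b). N $$ (0, Suc b))"
    and ?N = "mat p n (\<lambda>(a, b). N $$ (Suc a, Suc b))"
  show "?\<alpha> \<in> carrier_mat 1 1" "?\<beta> \<in> carrier_mat 1 n" "?N \<in> carrier_mat p n" by auto
  show "N = four_block_mat ?\<alpha> ?\<beta> (0\<^sub>m p 1) ?N"
    using assms by (intro eq_matI) auto
qed

text \<open>The first column is brought to a multiple of \<open>e\<^sub>1\<close> by its own singular value decomposition,
  which treats appreciable and infinitesimal columns alike; so the identity serves as the permutation in
  a unitary decomposition.\<close>

lemma unitary_triangularisation: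
  fixes M :: "dual_quat mat"
  assumes "M \<in> carrier_mat p n"
  shows "\<exists>H. unitary_mat p H \<and> upper_trapezoidal (conj_transpose H * M)"
  using assms
proof (induct p arbitrary: n M)
  case 0
  show ?case
    by (intro exI[of _ "1\<^sub>m 0"] conjI unitary_one) (simp add: upper_trapezoidal_def)
next
  case (Suc p n M)
  show ?case
  proof (cases n)
    case 0
    then show ?thesis
      using Suc.prems by (intro exI[of _ "1\<^sub>m (Suc p)"] conjI unitary_one) (simp add: upper_trapezoidal_def)
  next
    case (Suc n')
    note M = Suc.prems[unfolded Suc]
    obtain x M' where x: "x \<in> carrier_mat (Suc p) 1" and M': "M' \<in> carrier_mat (Suc p) n'"
      and MxM: "M = x @\<^sub>c M'"
      using split_cols[of M "Suc p" 1 n'] M by auto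
    obtain U V \<mu>s where U: "unitary_mat (Suc p) U" and V: "unitary_mat 1 V"
      and eq: "conj_transpose U * x * V = rect_diag (Suc p) 1 \<mu>s"
      using dual_quat_svd[OF x] by metis
    note Uc = unitary_matD(1-3)[OF U] and Vc = unitary_matD(1-3)[OF V]
    have "conj_transpose U * x = rect_diag (Suc p) 1 \<mu>s * conj_transpose V"
      using unitary_solve[OF U V x eq] Uc Vc
      by (simp add: rect_diag_def mat_mult_assoc unitary_cancel[OF U])
    then have "(conj_transpose U * x) $$ (a, 0) = 0" if "0 < a" "a < Suc p" for a
      using that Vc by (simp add: mat_entry_mult rect_diag_def del: index_mult_mat(1))
    moreover have "conj_transpose U * M = conj_transpose U * x @\<^sub>c conj_transpose U * M'"
      using Uc x M' unfolding MxM by (simp add: mult_append_cols)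
    ultimately have first: "(conj_transpose U * M) $$ (a, 0) = 0" if "0 < a" "a < Suc p" for a
      using that Uc x M' by (simp add: append_cols_entry del: index_mult_mat(1))
    have N: "conj_transpose U * M \<in> carrier_mat (Suc p) (Suc n')" using Uc M by auto
    obtain \<alpha> \<beta> N' where blocks: "\<alpha> \<in> carrier_mat 1 1" "\<beta> \<in> carrier_mat 1 n'" "N' \<in> carrier_mat p n'"
      and N_eq: "conj_transpose U * M = four_block_mat \<alpha> \<beta> (0\<^sub>m p 1) N'"
      using mat_four_block_first_col[OF N first] by blast
    obtain H' where H': "unitary_mat p H'" "upper_trapezoidal (conj_transpose H' * N')"
      using Suc.hyps[OF blocks(3)] by blast
    note H'c = unitary_matD(1-3)[OF H'(1)]
    let ?B = "four_block_mat (1\<^sub>m 1) (0\<^sub>m 1 p) (0\<^sub>m p 1) H'"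
    have B: "unitary_mat (Suc p) ?B"
      using unitary_block_diag[OF unitary_one[of 1] H'(1)] by simp
    have "conj_transpose (U * ?B) * M = conj_transpose ?B * (conj_transpose U * M)"
      using Uc M unitary_matD(2,3)[OF B] by (simp add: conj_transpose_mult mat_mult_assoc)
    also have "\<dots> = four_block_mat \<alpha> \<beta> (0\<^sub>m p 1) (conj_transpose H' * N')"
    proof -
      have cB: "conj_transpose ?B = four_block_mat (1\<^sub>m 1) (0\<^sub>m 1 p) (0\<^sub>m p 1) (conj_transpose H')"
        using H'c by (subst conj_transpose_four_block[of _ 1 1 _ p _ p]) auto
      moreover have "conj_transpose H' * N' \<in> carrier_mat p n'" using H'c blocks by auto
      ultimately show ?thesis
        unfolding N_eq cB using blocks H'c
        by (subst mult_four_block_mat[of _ 1 1 _ p _ p _ _ 1 _ n']) auto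
    qed
    also have "upper_trapezoidal \<dots>"
      using H'(2) blocks H'c unfolding upper_trapezoidal_def
      by (auto simp del: index_mult_mat(1))
    finally show ?thesis
      using unitary_mult[OF U B] by blast
  qed
qed

lemma rect_diag_append_rows:
  assumes "length \<mu>s \<le> p" "p \<le> m"
  shows "rect_diag m n \<mu>s = rect_diag p n \<mu>s @\<^sub>r 0\<^sub>m (m - p) n"
  using assms by (intro eq_matI) (auto simp: rect_diag_def append_rows_entry)

text \<open>In \<open>A = U \<Delta> V\<^sup>*\<close> only the first \<open>p\<close> columns \<open>X\<close> of \<open>U\<close> matter, so \<open>A = X M\<close> with \<open>M\<close> of
  \<open>p\<close> rows, and triangularising \<open>M\<close> gives the unitary decomposition. The remaining columns of \<open>U\<close>
  complete the left factor to a unitary matrix.\<close>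

lemma unitary_decomposition_exists:
  fixes A :: "dual_quat mat"
  assumes A: "A \<in> carrier_mat m n" and p: "dq_rank A = p"
  obtains Q Q' R where "unitary_decomposition A Q R" "p \<le> m" "p \<le> n"
    "Q \<in> carrier_mat m p" "R \<in> carrier_mat p n" "Q' \<in> carrier_mat m (m - p)" "A = Q * R"
    "unitary_mat m (Q @\<^sub>c Q')" "conj_transpose Q * Q = 1\<^sub>m p"
proof -
  obtain U V \<mu>s where U: "unitary_mat m U" and V: "unitary_mat n V" and len: "length \<mu>s = p"
    and le: "p \<le> m" "p \<le> n" and eq: "conj_transpose U * A * V = rect_diag m n \<mu>s"
    using dual_quat_svd_rank[OF A] unfolding p by metis
  note Uc = unitary_matD(1-3)[OF U] and Vc = unitary_matD(1-3)[OF V]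
  obtain X Y where X: "X \<in> carrier_mat m p" and Y: "Y \<in> carrier_mat m (m - p)" and XY: "U = X @\<^sub>c Y"
    using split_cols[of U m p "m - p"] Uc le by auto
  define M where "M = rect_diag p n \<mu>s * conj_transpose V"
  have M: "M \<in> carrier_mat p n"
    using Vc unfolding M_def by (intro mult_carrier_mat[of _ p n]) auto
  have "U * rect_diag m n \<mu>s = X * rect_diag p n \<mu>s + Y * 0\<^sub>m (m - p) n"
    unfolding XY rect_diag_append_rows[OF len[THEN eq_refl] le(1)]
    by (rule append_cols_mult_append_rows[OF X Y rect_diag_carrier zero_carrier_mat])
  also have "\<dots> = X * rect_diag p n \<mu>s"
    using X Y by auto
  finally have "U * rect_diag m n \<mu>s = X * rect_diag p n \<mu>s" .
  then have AXM: "A = X * M"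
    using unitary_solve[OF U V A eq] X Vc by (simp add: M_def rect_diag_def mat_mult_assoc)
  obtain H where H: "unitary_mat p H" and R: "upper_trapezoidal (conj_transpose H * M)"
    using unitary_triangularisation[OF M] by blast
  note Hc = unitary_matD(1-3)[OF H]
  let ?Q = "X * H" and ?R = "conj_transpose H * M"
  have Q: "?Q \<in> carrier_mat m p" and Rc: "?R \<in> carrier_mat p n" using X Hc M by auto
  have AQR: "A = ?Q * ?R"
    using X Hc M by (simp add: AXM mat_mult_assoc unitary_cancel[OF H])
  have "U * four_block_mat H (0\<^sub>m p (m - p)) (0\<^sub>m (m - p) p) (1\<^sub>m (m - p)) = ?Q @\<^sub>c Y"
    unfolding XY using X Y Hc by (subst append_cols_mult_block_diag) auto
  moreover have "unitary_mat m (four_block_mat H (0\<^sub>m p (m - p)) (0\<^sub>m (m - p) p) (1\<^sub>m (m - p)))"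
    using unitary_block_diag[OF H unitary_one[of "m - p"]] le by simp
  ultimately have QY: "unitary_mat m (?Q @\<^sub>c Y)"
    using unitary_mult[OF U] by metis
  have QQ: "conj_transpose ?Q * ?Q = 1\<^sub>m p"
    using unitary_append_cols_iff[of ?Q p "m - p" Y] Q Y QY le by simp
  have "permutation_mat n (1\<^sub>m n :: dual_quat mat)"
    unfolding permutation_mat_def by (intro exI[of _ id] conjI permutes_id) (auto intro!: eq_matI)
  moreover have "?R = ?R * transpose_mat (1\<^sub>m n)"
    by (simp only: transpose_one right_mult_one_mat[OF Rc])
  ultimately have "unitary_decomposition A ?Q ?R"
    unfolding unitary_decomposition_def Let_def p carrier_matD[OF A]
    using Q Rc AQR QQ R by blast
  then show ?thesis
    using that[OF _ le Q Rc Y AQR QY QQ] by blast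
qed

text \<open>If \<open>N\<close> has orthonormal columns then all its singular values are \<open>1\<close>, so its singular value
  decomposition exhibits \<open>N\<close>, up to a unitary change of its columns, as the first columns of a unitary
  matrix.\<close>

lemma unitary_completion:
  fixes N :: "dual_quat mat"
  assumes N: "N \<in> carrier_mat m s" and NN: "conj_transpose N * N = 1\<^sub>m s"
  obtains Y where "s \<le> m" "Y \<in> carrier_mat m (m - s)" "unitary_mat m (Y @\<^sub>c N)"
proof -
  obtain U V \<mu>s where U: "unitary_mat m U" and V: "unitary_mat s V"
    and len: "length \<mu>s \<le> m" "length \<mu>s \<le> s" and pos: "\<forall>\<mu>\<in>set \<mu>s. \<mu> > 0"
    and eq: "conj_transpose U * N * V = rect_diag m s \<mu>s"
    using dual_quat_svd[OF N] by metis
  note Uc = unitary_matD(1-3)[OF U] and Vc = unitary_matD(1-3)[OF V]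
  let ?D = "rect_diag m s \<mu>s"
  have "conj_transpose ?D * ?D = conj_transpose V * (conj_transpose N * N) * V"
    unfolding eq[symmetric] using Uc Vc N
    by (simp add: conj_transpose_mult mat_mult_assoc unitary_cancel[OF U])
  then have DD: "conj_transpose ?D * ?D = 1\<^sub>m s"
    using NN Vc unitary_matD(4)[OF V] by simp
  have entry: "(\<Sum>k<m. conjugate (?D $$ (k, b)) * ?D $$ (k, b)) = 1" if "b < s" for b
    using arg_cong[OF DD, of "\<lambda>M. M $$ (b, b)"] that
    by (simp add: mat_entry_mult rect_diag_def del: index_mult_mat(1))
  have "s \<le> length \<mu>s"
  proof (rule ccontr)
    assume "\<not> ?thesis"
    then have b: "length \<mu>s < s" by simp
    have "(\<Sum>k<m. conjugate (?D $$ (k, length \<mu>s)) * ?D $$ (k, length \<mu>s)) = 0"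
      using b by (intro sum.neutral) (auto simp: rect_diag_def)
    then show False using entry[OF b] by simp
  qed
  then have s: "length \<mu>s = s" "s \<le> m" using len by auto
  have one: "\<mu>s ! b = 1" if b: "b < s" for b
  proof -
    have "(\<Sum>k<m. conjugate (?D $$ (k, b)) * ?D $$ (k, b)) =
        (\<Sum>k<m. if k = b then dq_of_dual (\<mu>s ! b * \<mu>s ! b) else 0)"
      using b s by (intro sum.cong) (auto simp: rect_diag_def dq_of_dual_mult)
    also have "\<dots> = dq_of_dual (\<mu>s ! b * \<mu>s ! b)"
      using b s by (simp add: sum.delta)
    finally have "dq_of_dual (\<mu>s ! b * \<mu>s ! b) = dq_of_dual 1"
      using entry[OF b] by simp
    then have sq: "\<mu>s ! b * \<mu>s ! b = 1" by (simp only: dq_of_dual_inject)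
    then have "(std_part (\<mu>s ! b))\<^sup>2 = 1" "2 * (std_part (\<mu>s ! b) * dual_part (\<mu>s ! b)) = 0"
      unfolding dual_eq_iff by (simp_all add: power2_eq_square mult.commute)
    moreover have "\<mu>s ! b > 0" using pos b s by simp
    ultimately show ?thesis
      by (auto simp: dual_eq_iff less_dual_zero power2_eq_1_iff)
  qed
  then have D: "?D = 1\<^sub>m s @\<^sub>r 0\<^sub>m (m - s) s"
    using s by (intro eq_matI) (auto simp: rect_diag_def append_rows_entry)
  obtain X Y where X: "X \<in> carrier_mat m s" and Y: "Y \<in> carrier_mat m (m - s)" and XY: "U = X @\<^sub>c Y"
    using split_cols[of U m s "m - s"] Uc s by auto
  have "U * ?D = X * 1\<^sub>m s + Y * 0\<^sub>m (m - s) s"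
    unfolding D XY using X Y by (intro append_cols_mult_append_rows) auto
  also have "\<dots> = X" using X Y by auto
  finally have NX: "N = X * conj_transpose V"
    using unitary_solve[OF U V N eq] by simp
  have "U * four_block_mat (conj_transpose V) (0\<^sub>m s (m - s)) (0\<^sub>m (m - s) s) (1\<^sub>m (m - s)) = N @\<^sub>c Y"
    unfolding XY NX using X Y Vc by (subst append_cols_mult_block_diag) auto
  moreover have "unitary_mat m (four_block_mat (conj_transpose V) (0\<^sub>m s (m - s)) (0\<^sub>m (m - s) s) (1\<^sub>m (m - s)))"
    using unitary_block_diag[OF unitary_conj_transpose[OF V] unitary_one[of "m - s"]] s by simp
  ultimately have "unitary_mat m (N @\<^sub>c Y)"
    using unitary_mult[OF U] by metis
  then have "unitary_mat m (Y @\<^sub>c N)"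
    using unitary_swap_cols[of N s "m - s" Y] N Y s by simp
  then show ?thesis using that s Y by blast
qed

section \<open>The CS decomposition\<close>

text \<open>Since \<open>P\<close> is upward closed, its members form an initial segment of a decreasing list.\<close>

lemma sorted_eq_filter_append:
  assumes "sorted_wrt (\<ge>) xs" "\<And>x y. P y \<Longrightarrow> y \<le> (x :: 'a :: linorder) \<Longrightarrow> P x"
  shows "xs = filter P xs @ filter (\<lambda>x. \<not> P x) xs"
  using assms(1)
proof (induct xs)
  case (Cons x xs)
  show ?case
  proof (cases "P x")
    case False
    then have "filter P xs = []"
      using Cons.prems assms(2) by (auto simp: filter_empty_conv)
    then show ?thesis using False Cons by simp
  qed (use Cons in auto)
qed simp

lemma std_part_mono: "x \<le> y \<Longrightarrow> std_part x \<le> (std_part y :: 'a :: linorder)"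
  by (auto simp: less_eq_dual_def less_dual_def)

lemma rect_diag_gram:
  "conj_transpose (rect_diag m n \<mu>s) * rect_diag m n \<mu>s =
    mat n n (\<lambda>(a, b). if a = b \<and> a < m \<and> a < length \<mu>s then dq_of_dual (\<mu>s ! a * \<mu>s ! a) else 0)"
proof (rule eq_matI)
  let ?D = "rect_diag m n \<mu>s"
  let ?R = "mat n n (\<lambda>(a, b). if a = b \<and> a < m \<and> a < length \<mu>s then dq_of_dual (\<mu>s ! a * \<mu>s ! a) else 0)"
  fix a b assume "a < dim_row ?R" "b < dim_col ?R"
  then have ab: "a < n" "b < n" by auto
  then have "(conj_transpose ?D * ?D) $$ (a, b) = (\<Sum>k<m. conjugate (?D $$ (k, a)) * ?D $$ (k, b))"
    by (simp add: mat_entry_mult rect_diag_def del: index_mult_mat(1))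
  also have "\<dots> = (\<Sum>k<m. if k = a then
      (if a = b \<and> a < length \<mu>s then dq_of_dual (\<mu>s ! a * \<mu>s ! a) else 0) else 0)"
    using ab by (intro sum.cong) (auto simp: rect_diag_def dq_of_dual_mult)
  also have "\<dots> = ?R $$ (a, b)"
    using ab by (simp add: sum.delta)
  finally show "(conj_transpose ?D * ?D) $$ (a, b) = ?R $$ (a, b)" .
qed (auto simp: rect_diag_def)

lemma conj_transpose_mat_diag:
  fixes f :: "nat \<Rightarrow> 'a :: star_ring"
  shows "conj_transpose (mat_diag n f) = mat_diag n (\<lambda>a. conjugate (f a))"
  by (intro eq_matI) (auto simp: mat_diag_def)

definition dual_cosine_to_sine :: "dual_number \<Rightarrow> dual_number" where
  "dual_cosine_to_sine c = dual_sqrt (1 - c * c)"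

lemma std_part_sine: "std_part (dual_cosine_to_sine c) = sqrt (1 - (std_part c)\<^sup>2)"
  by (simp add: dual_cosine_to_sine_def power2_eq_square)

lemma sine_square:
  assumes "std_part c < 1" "0 \<le> std_part c"
  shows "dual_cosine_to_sine c * dual_cosine_to_sine c = 1 - c * c"
proof -
  have "(std_part c)\<^sup>2 < 1" using assms by (simp add: power2_eq_square abs_square_less_1 power_less_one_iff
        flip: power2_eq_square)
  then show ?thesis
    unfolding dual_cosine_to_sine_def by (intro dual_sqrt_mult_self) (simp add: power2_eq_square)
qed

lemma sine_bounds:
  assumes "std_part c < 1" "0 < std_part c"
  shows "appreciable (dual_cosine_to_sine c)" "0 < dual_cosine_to_sine c" "dual_cosine_to_sine c < 1"
proof -
  have "0 < (std_part c)\<^sup>2" "(std_part c)\<^sup>2 < 1"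
    using assms by (simp_all add: power_less_one_iff)
  then have "0 < std_part (dual_cosine_to_sine c)" "std_part (dual_cosine_to_sine c) < 1"
    by (simp_all add: std_part_sine)
  then show "appreciable (dual_cosine_to_sine c)" "0 < dual_cosine_to_sine c" "dual_cosine_to_sine c < 1"
    by (simp_all add: appreciable_def less_dual_def)
qed

text \<open>If the standard parts agree then the lexicographic order is decided by the dual parts. For
  \<open>c = a + b\<epsilon>\<close> the sine has dual part \<open>- a b / sqrt (1 - a\<^sup>2)\<close>, which decreases in \<open>b\<close> because
  \<open>a > 0\<close>.\<close>

lemma sine_antimono:
  assumes "std_part c < 1" "0 < std_part c'" "c' \<le> c"
  shows "dual_cosine_to_sine c \<le> dual_cosine_to_sine c'"
proof (cases "std_part c = std_part c'")
  case True
  then have "dual_part c' \<le> dual_part c"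
    using assms(3) by (auto simp: less_eq_dual_def less_dual_def)
  moreover have "(std_part c)\<^sup>2 < 1" using assms True by (simp add: power_less_one_iff)
  ultimately have "dual_part (dual_cosine_to_sine c) \<le> dual_part (dual_cosine_to_sine c')"
    using assms True
    by (simp add: dual_cosine_to_sine_def dual_sqrt_def power2_eq_square divide_right_mono)
  moreover have "std_part (dual_cosine_to_sine c) = std_part (dual_cosine_to_sine c')"
    by (simp add: std_part_sine True)
  ultimately show ?thesis by (auto simp: less_eq_dual_def less_dual_def dual_eq_iff)
next
  case False
  then have "std_part c' < std_part c" using std_part_mono[OF assms(3)] by simp
  then have "(std_part c')\<^sup>2 < (std_part c)\<^sup>2" using assms by (simp add: power_strict_mono)
  then have "std_part (dual_cosine_to_sine c) < std_part (dual_cosine_to_sine c')"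
    by (simp add: std_part_sine)
  then show ?thesis by (simp add: less_eq_dual_def less_dual_def)
qed

text \<open>The singular values \<open>\<mu>\<close> of \<open>W\<^sub>1\<close> are read off first. Since the Gram matrices of \<open>W\<^sub>1\<close> and \<open>W\<^sub>2\<close>
  add up to the identity, the columns of \<open>Z = W\<^sub>2 V\<close> are orthogonal with squared lengths \<open>1 - \<mu>\<^sup>2\<close>.
  If \<open>\<mu>\<close> has standard part \<open>1\<close>, the column is infinitesimal, so its squared length is exactly \<open>0\<close> and
  \<open>\<mu> = 1\<close>; all other columns have an invertible length and can be normalised.\<close>

lemma singular_values_of_isometry_block:
  fixes W1 W2 :: "dual_quat mat"
  assumes W1: "W1 \<in> carrier_mat q p" and W2: "W2 \<in> carrier_mat m p"
    and sum: "conj_transpose W1 * W1 + conj_transpose W2 * W2 = 1\<^sub>m p"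
    and U: "unitary_mat q U" and V: "unitary_mat p V" and len: "length \<mu>s \<le> q" "length \<mu>s \<le> p"
    and pos: "\<forall>\<mu>\<in>set \<mu>s. \<mu> > 0" and eq: "conj_transpose U * W1 * V = rect_diag q p \<mu>s"
  defines "Z \<equiv> W2 * V" and "t \<equiv> \<lambda>a. if a < length \<mu>s then \<mu>s ! a else 0"
  shows "conj_transpose Z * Z = mat_diag p (\<lambda>a. dq_of_dual (1 - t a * t a))"
    and "\<And>b. b < p \<Longrightarrow> std_part (t b) \<le> 1"
    and "\<And>b. b < p \<Longrightarrow> std_part (t b) = 1 \<Longrightarrow> t b = 1"
    and "\<And>a b. a < m \<Longrightarrow> b < p \<Longrightarrow> std_part (t b) = 1 \<Longrightarrow> std_part (Z $$ (a, b)) = 0"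
proof -
  note Uc = unitary_matD(1-3)[OF U] and Vc = unitary_matD(1-3)[OF V]
  have Z: "Z \<in> carrier_mat m p" using W2 Vc by (simp add: Z_def)
  let ?D = "rect_diag q p \<mu>s"
  have DD: "conj_transpose ?D * ?D = conj_transpose V * (conj_transpose W1 * W1) * V"
    unfolding eq[symmetric] using Uc Vc W1
    by (simp add: conj_transpose_mult mat_mult_assoc unitary_cancel[OF U])
  have ZZ: "conj_transpose Z * Z = conj_transpose V * (conj_transpose W2 * W2) * V"
    using Vc W2 by (simp add: Z_def conj_transpose_mult mat_mult_assoc)
  have c: "conj_transpose W1 * W1 \<in> carrier_mat p p" "conj_transpose W2 * W2 \<in> carrier_mat p p"
    using W1 W2 by auto
  then have c': "conj_transpose V * (conj_transpose W1 * W1) \<in> carrier_mat p p"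
    "conj_transpose V * (conj_transpose W2 * W2) \<in> carrier_mat p p"
    using Vc by (auto intro!: mult_carrier_mat[of "conj_transpose V" p p])
  have "conj_transpose ?D * ?D + conj_transpose Z * Z =
      conj_transpose V * (conj_transpose W1 * W1 + conj_transpose W2 * W2) * V"
    unfolding DD ZZ using Vc c c'
    by (simp add: mult_add_distrib_mat[of _ p p _ p] add_mult_distrib_mat[of _ p p _ _ p])
  also have "\<dots> = 1\<^sub>m p"
    unfolding sum using Vc unitary_matD(4)[OF V] by simp
  finally have total: "conj_transpose ?D * ?D + conj_transpose Z * Z = 1\<^sub>m p" .
  show gram: "conj_transpose Z * Z = mat_diag p (\<lambda>a. dq_of_dual (1 - t a * t a))"
  proof (rule eq_matI)
    fix a b assume "a < dim_row (mat_diag p (\<lambda>a. dq_of_dual (1 - t a * t a)))"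
      "b < dim_col (mat_diag p (\<lambda>a. dq_of_dual (1 - t a * t a)))"
    then have ab: "a < p" "b < p" by (simp_all add: mat_diag_def)
    have "(conj_transpose ?D * ?D) $$ (a, b) + (conj_transpose Z * Z) $$ (a, b) = (if a = b then 1 else 0)"
      using arg_cong[OF total, of "\<lambda>M. M $$ (a, b)"] ab Z by simp
    moreover have "(conj_transpose ?D * ?D) $$ (a, b) = (if a = b then dq_of_dual (t a * t a) else 0)"
      unfolding rect_diag_gram using ab len by (auto simp: t_def)
    ultimately show "(conj_transpose Z * Z) $$ (a, b) = mat_diag p (\<lambda>a. dq_of_dual (1 - t a * t a)) $$ (a, b)"
      using ab by (auto simp: mat_diag_def dq_of_dual_diff eq_diff_eq add.commute)
  qed (use Z in \<open>auto simp: mat_diag_def\<close>)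
  have entry: "(\<Sum>k<m. conjugate (Z $$ (k, b)) * Z $$ (k, b)) = dq_of_dual (1 - t b * t b)" if "b < p" for b
    using arg_cong[OF gram, of "\<lambda>M. M $$ (b, b)"] that Z
    by (simp add: mat_diag_def mat_entry_mult del: index_mult_mat(1))
  have norm: "(\<Sum>k<m. qnorm2 (std_part (Z $$ (k, b)))) = 1 - (std_part (t b))\<^sup>2" if "b < p" for b
  proof -
    have "(of_real (\<Sum>k<m. qnorm2 (std_part (Z $$ (k, b)))) :: quat) = of_real (1 - (std_part (t b))\<^sup>2)"
      using arg_cong[OF entry[OF that], of std_part]
      by (simp add: dual_parts_sum conjugate_times_quat power2_eq_square)
    then show ?thesis by (simp only: of_real_eq_iff)
  qed
  show "std_part (t b) \<le> 1" if "b < p" for b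
  proof -
    have "0 \<le> 1 - (std_part (t b))\<^sup>2"
      unfolding norm[OF that, symmetric] by (intro sum_nonneg) simp
    then show ?thesis by (simp add: abs_square_le_1)
  qed
  show zero: "std_part (Z $$ (a, b)) = 0" if "a < m" "b < p" "std_part (t b) = 1" for a b
  proof -
    have "(\<Sum>k<m. qnorm2 (std_part (Z $$ (k, b)))) = 0"
      using norm that by simp
    then show ?thesis using that by (subst (asm) sum_nonneg_eq_0_iff) auto
  qed
  show "t b = 1" if b: "b < p" "std_part (t b) = 1" for b
  proof -
    have "dual_part (\<Sum>k<m. conjugate (Z $$ (k, b)) * Z $$ (k, b)) = 0"
      using zero b by (simp add: dual_parts_sum)
    then have "of_real (dual_part (1 - t b * t b)) = (0 :: quat)"
      unfolding entry[OF b(1)] by simp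
    then have "dual_part (1 - t b * t b) = 0" by (simp only: of_real_eq_0_iff)
    then show ?thesis using b(2) by (simp add: dual_eq_iff)
  qed
qed

lemma mat_diag_unit:
  fixes f g :: "nat \<Rightarrow> 'a :: ring_1"
  assumes "\<And>a. a < n \<Longrightarrow> f a * g a = 1"
  shows "mat_diag n f * mat_diag n g = 1\<^sub>m n"
  unfolding mat_diag_diag using assms by (intro eq_matI) (auto simp: mat_diag_def)

text \<open>Two singular value decompositions are combined. The first one diagonalises \<open>W\<^sub>1\<close> and makes the
  columns of \<open>Z = W\<^sub>2 V\<close> orthogonal. The columns \<open>Z\<^sub>2\<close> that belong to \<open>\<mu> \<noteq> 1\<close> are normalised to \<open>N\<close> and
  completed by \<open>Y\<close>. The columns \<open>Z\<^sub>1\<close> that belong to \<open>\<mu> = 1\<close> are infinitesimal and orthogonal to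
  \<open>Z\<^sub>2\<close>, but orthogonality to each other says nothing because their products vanish; the second
  decomposition, of \<open>Y\<^sup>* Z\<^sub>1\<close>, diagonalises them and produces \<open>\<Sigma>\<epsilon>\<close>.\<close>

theorem dual_quat_cs_decomposition:
  fixes W1 W2 :: "dual_quat mat"
  assumes W1: "W1 \<in> carrier_mat q p" and W2: "W2 \<in> carrier_mat m p"
    and sum: "conj_transpose W1 * W1 + conj_transpose W2 * W2 = 1\<^sub>m p"
  obtains U1 U2 V1 i \<sigma>s ds cs
  where "unitary_mat q U1" "unitary_mat m U2" "unitary_mat p V1"
    "i + length cs + length ds \<le> p" "i + length cs + length ds \<le> q"
    "length \<sigma>s \<le> i" "length \<sigma>s + (p - i) \<le> m"
    "sorted_wrt (\<ge>) \<sigma>s" "\<forall>\<sigma>\<in>set \<sigma>s. \<sigma> > 0" "\<forall>d\<in>set ds. d > 0"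
    "sorted_wrt (\<ge>) cs" "\<forall>c\<in>set cs. 0 < std_part c \<and> std_part c < 1"
    "conj_transpose U1 * W1 * V1 = rect_diag q p (replicate i 1 @ cs @ map (Dual 0) ds)"
    "conj_transpose U2 * W2 * V1 =
      four_block_mat (rect_diag (m - (p - i)) i (map (Dual 0) \<sigma>s)) (0\<^sub>m (m - (p - i)) (p - i))
        (0\<^sub>m (p - i) i) (rect_diag (p - i) (p - i)
          (map dual_cosine_to_sine cs @ replicate (p - i - length cs) 1))"
proof -
  obtain U V \<mu>s where U: "unitary_mat q U" and V: "unitary_mat p V"
    and len: "length \<mu>s \<le> q" "length \<mu>s \<le> p"
    and sorted: "sorted_wrt (\<ge>) \<mu>s" and pos: "\<forall>\<mu>\<in>set \<mu>s. \<mu> > 0"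
    and eq: "conj_transpose U * W1 * V = rect_diag q p \<mu>s"
    using dual_quat_svd[OF W1] by metis
  note Uc = unitary_matD(1-3)[OF U] and Vc = unitary_matD(1-3)[OF V]
  define Z where "Z = W2 * V"
  define t where "t a = (if a < length \<mu>s then \<mu>s ! a else 0)" for a
  note sv = singular_values_of_isometry_block[OF W1 W2 sum U V len pos eq, folded Z_def t_def]
  have Z: "Z \<in> carrier_mat m p" using W2 Vc by (simp add: Z_def)

  \<comment> \<open>The three ranges of singular values: equal to \<open>1\<close>, appreciable below \<open>1\<close>, infinitesimal.\<close>
  define xs where "xs = filter (\<lambda>\<mu>. std_part \<mu> \<ge> 1) \<mu>s"
  define rest where "rest = filter (\<lambda>\<mu>. \<not> std_part \<mu> \<ge> 1) \<mu>s"
  define cs where "cs = filter (\<lambda>\<mu>. std_part \<mu> > 0) rest"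
  define zs where "zs = filter (\<lambda>\<mu>. \<not> std_part \<mu> > 0) rest"
  define ds where "ds = map dual_part zs"
  define i where "i = length xs"
  have sorted_rest: "sorted_wrt (\<ge>) rest"
    unfolding rest_def by (rule sorted_wrt_filter[OF sorted])
  have "\<mu>s = xs @ rest"
    unfolding xs_def rest_def
    by (rule sorted_eq_filter_append[OF sorted]) (use std_part_mono order_trans in blast)
  moreover have "rest = cs @ zs"
    unfolding cs_def zs_def
    by (rule sorted_eq_filter_append[OF sorted_rest]) (use std_part_mono less_le_trans in blast)
  ultimately have \<mu>s: "\<mu>s = xs @ cs @ zs" by simp
  have bound: "std_part \<mu> \<le> 1 \<and> (std_part \<mu> = 1 \<longrightarrow> \<mu> = 1)" if "\<mu> \<in> set \<mu>s" for \<mu>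
  proof -
    from that obtain a where "a < length \<mu>s" "\<mu> = \<mu>s ! a" by (auto simp: in_set_conv_nth)
    then show ?thesis using sv(2,3)[of a] len by (auto simp: t_def)
  qed
  then have "\<forall>x\<in>set xs. x = 1" by (auto simp: xs_def intro: order_antisym)
  then have xs: "xs = replicate i 1" unfolding i_def by (metis replicate_length_same)
  have cs: "\<forall>c\<in>set cs. 0 < std_part c \<and> std_part c < 1"
    by (auto simp: cs_def rest_def)
  have zs_std: "\<forall>z\<in>set zs. std_part z = 0 \<and> 0 < dual_part z"
    using pos by (auto simp: zs_def rest_def less_dual_zero)
  then have zs: "zs = map (Dual 0) ds"
    by (auto simp: ds_def comp_def dual_eq_iff intro!: map_idI[symmetric])
  have \<mu>s_eq: "\<mu>s = replicate i 1 @ cs @ map (Dual 0) ds" using \<mu>s xs zs by simp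
  have lens: "i + length cs + length ds = length \<mu>s" by (simp add: \<mu>s_eq)
  define e where "e = p - i"
  have ie: "p = i + e" "i \<le> q" using len lens by (auto simp: e_def)

  \<comment> \<open>The lengths of the columns of \<open>Z\<close> beyond the first \<open>i\<close>.\<close>
  define ws where "ws = map dual_cosine_to_sine cs @ replicate (e - length cs) 1"
  have len_ws: "length ws = e" using lens len by (simp add: ws_def e_def)
  have ws: "std_part (ws ! b) > 0 \<and> ws ! b * ws ! b = 1 - t (i + b) * t (i + b)" if b: "b < e" for b
  proof (cases "b < length cs")
    case True
    then have "t (i + b) = cs ! b" by (simp add: t_def \<mu>s_eq nth_append)
    moreover have "cs ! b \<in> set cs" using True by simp
    then have "0 < std_part (cs ! b)" "std_part (cs ! b) < 1" using cs by auto
    ultimately show ?thesis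
      using True sine_square[of "cs ! b"] sine_bounds[of "cs ! b"]
      by (simp add: ws_def nth_append less_dual_zero appreciable_def)
  next
    case False
    then have "ws ! b = 1" using b len_ws by (simp add: ws_def nth_append)
    moreover have "std_part (t (i + b)) = 0"
    proof (cases "i + b < length \<mu>s")
      case True
      then have "t (i + b) = Dual 0 (ds ! (b - length cs))"
        using False lens by (simp add: t_def \<mu>s_eq nth_append)
      then show ?thesis by simp
    qed (simp add: t_def)
    then have "t (i + b) * t (i + b) = 0" by (simp add: dual_eq_iff)
    ultimately show ?thesis by simp
  qed
  define Z1 where "Z1 = mat m i (\<lambda>(a, b). Z $$ (a, b))"
  define Z2 where "Z2 = mat m e (\<lambda>(a, b). Z $$ (a, i + b))"
  have Z1: "Z1 \<in> carrier_mat m i" and Z2: "Z2 \<in> carrier_mat m e" by (simp_all add: Z1_def Z2_def)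
  have ZZ: "Z = Z1 @\<^sub>c Z2"
    using Z ie by (intro eq_matI) (auto simp: append_cols_entry Z1_def Z2_def)
  have gram: "(\<Sum>k<m. conjugate (Z $$ (k, a)) * Z $$ (k, b)) = (if a = b then dq_of_dual (1 - t b * t b) else 0)"
    if "a < p" "b < p" for a b
    using arg_cong[OF sv(1), of "\<lambda>M. M $$ (a, b)"] that Z
    by (simp add: mat_diag_def mat_entry_mult del: index_mult_mat(1))
  define D where "D = mat_diag e (\<lambda>b. dq_of_dual (ws ! b))"
  define D' where "D' = mat_diag e (\<lambda>b. dq_of_dual (dual_inverse (ws ! b)))"
  have D: "D \<in> carrier_mat e e" "D' \<in> carrier_mat e e" "conj_transpose D' = D'"
    by (simp_all add: D_def D'_def conj_transpose_mat_diag)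
  have "ws ! b * dual_inverse (ws ! b) = 1" if "b < e" for b
    using ws[OF that] by (intro dual_inverse_mult) simp
  then have DD': "D * D' = 1\<^sub>m e" "D' * D = 1\<^sub>m e"
    unfolding D_def D'_def
    by (intro mat_diag_unit; simp add: mult.commute flip: dq_of_dual_mult)+
  have Z2Z2: "conj_transpose Z2 * Z2 = D * D"
    unfolding D_def mat_diag_diag
    using ie gram ws by (intro eq_matI)
      (auto simp: mat_entry_mult Z2_def mat_diag_def simp del: index_mult_mat(1) simp flip: dq_of_dual_mult)
  have Z2Z1: "conj_transpose Z2 * Z1 = 0\<^sub>m e i"
    using ie gram by (intro eq_matI) (auto simp: mat_entry_mult Z2_def Z1_def simp del: index_mult_mat(1))
  define N where "N = Z2 * D'"
  have N: "N \<in> carrier_mat m e" using Z2 D by (simp add: N_def)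
  have cN: "conj_transpose N = D' * conj_transpose Z2"
    using Z2 D by (simp add: N_def conj_transpose_mult)
  have ND: "N * D = Z2"
    using Z2 D DD' by (simp add: N_def mat_mult_assoc)
  have NN: "conj_transpose N * N = 1\<^sub>m e"
  proof -
    have "conj_transpose N * N = D' * (conj_transpose Z2 * Z2) * D'"
      unfolding cN using Z2 D by (simp add: N_def mat_mult_assoc)
    also have "\<dots> = (D' * D) * (D * D')"
      unfolding Z2Z2 using D by (simp add: mat_mult_assoc)
    finally show ?thesis by (simp add: DD')
  qed
  have NZ1: "conj_transpose N * Z1 = 0\<^sub>m e i"
    unfolding cN using Z2 Z1 D by (simp add: mat_mult_assoc Z2Z1)
  obtain Y where em: "e \<le> m" and Y: "Y \<in> carrier_mat m (m - e)" and YN: "unitary_mat m (Y @\<^sub>c N)"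
    using unitary_completion[OF N NN] by blast
  have YNO: "conj_transpose Y * N = 0\<^sub>m (m - e) e"
    using unitary_append_cols_iff[of Y "m - e" e N] Y N YN em by simp
  have YZ2: "conj_transpose Y * Z2 = 0\<^sub>m (m - e) e"
  proof -
    have "conj_transpose Y * Z2 = conj_transpose Y * N * D"
      using Y N D by (simp add: mat_mult_assoc ND)
    then show ?thesis using D by (simp add: YNO)
  qed
  have NZ2: "conj_transpose N * Z2 = D"
  proof -
    have "conj_transpose N * Z2 = conj_transpose N * N * D"
      using N D by (simp add: mat_mult_assoc ND)
    then show ?thesis using D by (simp add: NN)
  qed
  have YNZ: "conj_transpose (Y @\<^sub>c N) * W2 * V =
      four_block_mat (conj_transpose Y * Z1) (0\<^sub>m (m - e) e) (0\<^sub>m e i) D"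
  proof -
    have "conj_transpose (Y @\<^sub>c N) * W2 * V = (conj_transpose Y @\<^sub>r conj_transpose N) * (Z1 @\<^sub>c Z2)"
      unfolding ZZ[symmetric] Z_def using Y N W2 Vc by (simp add: conj_transpose_append_cols mat_mult_assoc)
    also have "\<dots> = four_block_mat (conj_transpose Y * Z1) (conj_transpose Y * Z2)
        (conj_transpose N * Z1) (conj_transpose N * Z2)"
      using Y N Z1 Z2 by (intro append_rows_mult_append_cols[of _ "m - e" m _ e _ i _ e]) auto
    finally show ?thesis by (simp add: YZ2 NZ1 NZ2)
  qed

  \<comment> \<open>The first \<open>i\<close> columns are infinitesimal, so the singular values of \<open>Y\<^sup>* Z\<^sub>1\<close> are, too.\<close>
  have YZ1: "conj_transpose Y * Z1 \<in> carrier_mat (m - e) i" using Y Z1 by auto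
  obtain U3 V3 \<tau>s where U3: "unitary_mat (m - e) U3" and V3: "unitary_mat i V3"
    and len3: "length \<tau>s \<le> m - e" "length \<tau>s \<le> i"
    and sorted3: "sorted_wrt (\<ge>) \<tau>s" and pos3: "\<forall>\<tau>\<in>set \<tau>s. \<tau> > 0"
    and eq3: "conj_transpose U3 * (conj_transpose Y * Z1) * V3 = rect_diag (m - e) i \<tau>s"
    using dual_quat_svd[OF YZ1] by metis
  note U3c = unitary_matD(1-3)[OF U3] and V3c = unitary_matD(1-3)[OF V3]
  have t1: "t b = 1" if "b < i" for b
    using that lens by (simp add: t_def \<mu>s_eq nth_append)
  have "map_mat std_part Z1 = 0\<^sub>m m i"
    using sv(4) t1 ie by (intro eq_matI) (auto simp: Z1_def)
  then have zero3: "map_mat std_part (rect_diag (m - e) i \<tau>s) = 0\<^sub>m (m - e) i"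
    unfolding eq3[symmetric] using U3c V3c Y Z1 by (simp add: std_mat_mult)
  have "std_part (rect_diag (m - e) i \<tau>s $$ (a, a)) = 0" if "a < length \<tau>s" for a
    using arg_cong[OF zero3, of "\<lambda>M. M $$ (a, a)"] that len3 by (simp add: rect_diag_def)
  then have "std_part (\<tau>s ! a) = 0" if "a < length \<tau>s" for a
    using that len3 by (simp add: rect_diag_def)
  then have \<tau>_std: "std_part \<tau> = 0" if "\<tau> \<in> set \<tau>s" for \<tau>
    using that by (auto simp: in_set_conv_nth)
  define \<sigma>s where "\<sigma>s = map dual_part \<tau>s"
  have \<tau>s: "\<tau>s = map (Dual 0) \<sigma>s"
    using \<tau>_std by (auto simp: \<sigma>s_def comp_def dual_eq_iff intro!: map_idI[symmetric])
  have \<sigma>s: "sorted_wrt (\<ge>) \<sigma>s" "\<forall>\<sigma>\<in>set \<sigma>s. \<sigma> > 0" "length \<sigma>s = length \<tau>s"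
    using sorted3 pos3 unfolding \<tau>s
    by (auto simp: sorted_wrt_map less_eq_dual_def less_dual_def elim: sorted_wrt_mono_rel[rotated])

  \<comment> \<open>The rotation \<open>V\<^sub>3\<close> acts where the upper block is the identity, so \<open>U\<^sub>1\<close> can undo it there.\<close>
  let ?BU = "four_block_mat V3 (0\<^sub>m i (q - i)) (0\<^sub>m (q - i) i) (1\<^sub>m (q - i))"
  let ?BV = "four_block_mat V3 (0\<^sub>m i e) (0\<^sub>m e i) (1\<^sub>m e)"
  let ?BW = "four_block_mat U3 (0\<^sub>m (m - e) e) (0\<^sub>m e (m - e)) (1\<^sub>m e)"
  have BU: "unitary_mat q ?BU" and BV: "unitary_mat p ?BV" and BW: "unitary_mat m ?BW"
    using unitary_block_diag[OF V3 unitary_one[of "q - i"]] unitary_block_diag[OF V3 unitary_one[of e]]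
      unitary_block_diag[OF U3 unitary_one[of e]] ie em by auto
  have "conj_transpose (U * ?BU) * W1 * (V * ?BV) = conj_transpose ?BU * rect_diag q p \<mu>s * ?BV"
    unfolding eq[symmetric] using Uc Vc W1 unitary_matD(1)[OF BU] unitary_matD(1)[OF BV]
    by (intro conj_transpose_mult_mult) auto
  also have "rect_diag q p \<mu>s =
      four_block_mat (1\<^sub>m i) (0\<^sub>m i e) (0\<^sub>m (q - i) i) (rect_diag (q - i) e (cs @ map (Dual 0) ds))"
    unfolding \<mu>s_eq using ie
    by (intro eq_matI) (auto simp: rect_diag_def nth_append split: if_splits)
  also have "conj_transpose ?BU * \<dots> * ?BV = \<dots>"
    using V3c by (subst conj_block_diag_mult) (auto simp: unitary_matD(4)[OF V3] rect_diag_def)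
  also have "\<dots> = rect_diag q p (replicate i 1 @ cs @ map (Dual 0) ds)"
    using ie by (intro eq_matI) (auto simp: rect_diag_def nth_append split: if_splits)
  finally have top: "conj_transpose (U * ?BU) * W1 * (V * ?BV) =
    rect_diag q p (replicate i 1 @ cs @ map (Dual 0) ds)" .
  have "conj_transpose ((Y @\<^sub>c N) * ?BW) * W2 * (V * ?BV) =
      conj_transpose ?BW * (conj_transpose (Y @\<^sub>c N) * W2 * V) * ?BV"
    using unitary_matD(1)[OF YN] Vc W2 unitary_matD(1)[OF BW] unitary_matD(1)[OF BV]
    by (intro conj_transpose_mult_mult) auto
  also have "\<dots> = four_block_mat (rect_diag (m - e) i \<tau>s) (0\<^sub>m (m - e) e) (0\<^sub>m e i) D"
    unfolding YNZ using U3c V3c D(1) YZ1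
    by (subst conj_block_diag_mult) (auto simp: eq3)
  also have "D = rect_diag e e ws"
    unfolding D_def mat_diag_def rect_diag_def using len_ws by (intro eq_matI) auto
  finally have bot: "conj_transpose ((Y @\<^sub>c N) * ?BW) * W2 * (V * ?BV) =
    four_block_mat (rect_diag (m - e) i (map (Dual 0) \<sigma>s)) (0\<^sub>m (m - e) e) (0\<^sub>m e i) (rect_diag e e ws)"
    unfolding \<tau>s .
  show ?thesis
  proof (rule that[OF unitary_mult[OF U BU] unitary_mult[OF YN BW] unitary_mult[OF V BV],
        of i cs ds \<sigma>s])
    show "sorted_wrt (\<ge>) cs" unfolding cs_def by (rule sorted_wrt_filter[OF sorted_rest])
    show "\<forall>d\<in>set ds. 0 < d" using zs_std by (auto simp: ds_def)
    show "length \<sigma>s + (p - i) \<le> m" using \<sigma>s(3) len3 em ie by simp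
  qed (use top bot len lens \<sigma>s len3 cs in \<open>simp_all add: ws_def flip: e_def\<close>)
qed

section \<open>The simultaneous decomposition of two matrices\<close>

lemma of_real_dual: "(of_real x :: dual_quat) = Dual (of_real x) 0"
  by (simp add: of_real_def scaleR_dual_def one_dual_def)

lemma eps_of_real: "\<epsilon> * (of_real x :: dual_quat) = dq_of_dual (Dual 0 x)"
  by (simp add: of_real_dual dual_eq_iff dual_eps_def)

text \<open>The nested block rows below are turned into nested block diagonal matrices by the next three
  laws: blocks of zeros are merged, a common zero column is moved out, and a first row and a first
  column that vanish off the diagonal are split off.\<close>

lemma zero_append_cols: "0\<^sub>m a b @\<^sub>c 0\<^sub>m a c = 0\<^sub>m a (b + c)"
  by (intro eq_matI) (auto simp: append_cols_entry)

lemma zero_col_append_rows: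
  "dim_row X = a \<Longrightarrow> dim_row Y = b \<Longrightarrow> dim_col X = dim_col Y \<Longrightarrow>
   (0\<^sub>m a c @\<^sub>c X) @\<^sub>r (0\<^sub>m b c @\<^sub>c Y) = 0\<^sub>m (a + b) c @\<^sub>c (X @\<^sub>r Y)"
  by (intro eq_matI) (auto simp: append_cols_entry append_rows_entry)

lemma append_rows_block_diag:
  "dim_row A = a \<Longrightarrow> dim_col A = c \<Longrightarrow> dim_row D = b \<Longrightarrow> dim_col D = d \<Longrightarrow>
   (A @\<^sub>c 0\<^sub>m a d) @\<^sub>r (0\<^sub>m b c @\<^sub>c D) = four_block_mat A (0\<^sub>m a d) (0\<^sub>m b c) D"
  by (intro eq_matI) (auto simp: append_cols_entry append_rows_entry)

lemma block_diag_rect_diag: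
  "length xs = a \<Longrightarrow> four_block_mat (rect_diag a a xs) (0\<^sub>m a c) (0\<^sub>m b a) (rect_diag b c ys) =
    rect_diag (a + b) (a + c) (xs @ ys)"
  by (intro eq_matI) (auto simp: rect_diag_def nth_append split: if_splits)

lemma one_mat_rect_diag: "1\<^sub>m a = rect_diag a a (replicate a 1)"
  by (intro eq_matI) (auto simp: rect_diag_def)

lemma zero_mat_rect_diag: "0\<^sub>m a b = rect_diag a b []"
  by (intro eq_matI) (auto simp: rect_diag_def)

lemma diag_of_list_rect_diag:
  "diag_of_list (map dq_of_dual xs) = rect_diag (length xs) (length xs) xs"
  "\<epsilon> \<cdot>\<^sub>m diag_of_list (map of_real ys) = rect_diag (length ys) (length ys) (map (Dual 0) ys)"
  by (intro eq_matI; auto simp: rect_diag_def diag_of_list_def mat_diag_def eps_of_real)+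

lemma block_diag_zero_block:
  assumes "length xs = r" "W \<in> carrier_mat d d"
  shows "four_block_mat (rect_diag r r xs) (0\<^sub>m r (i' + d)) (0\<^sub>m (z + d) r)
      (four_block_mat (0\<^sub>m z i') (0\<^sub>m z d) (0\<^sub>m d i') W) =
    four_block_mat (rect_diag (r + z) (r + i') xs) (0\<^sub>m (r + z) d) (0\<^sub>m d (r + i')) W"
  using assms by (intro eq_matI) (auto simp: rect_diag_def)

lemma Sigma_A_top:
  assumes C: "C = diag_of_list (map dq_of_dual cs)" "length cs = j"
    and D: "D = diag_of_list (map of_real ds)" "length ds = k"
  shows "((1\<^sub>m r    @\<^sub>c 0\<^sub>m r i' @\<^sub>c 0\<^sub>m r j  @\<^sub>c 0\<^sub>m r k  @\<^sub>c 0\<^sub>m r e) @\<^sub>r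
       (0\<^sub>m i' r @\<^sub>c 1\<^sub>m i'   @\<^sub>c 0\<^sub>m i' j @\<^sub>c 0\<^sub>m i' k @\<^sub>c 0\<^sub>m i' e) @\<^sub>r
       (0\<^sub>m j r  @\<^sub>c 0\<^sub>m j i' @\<^sub>c C       @\<^sub>c 0\<^sub>m j k  @\<^sub>c 0\<^sub>m j e) @\<^sub>r
       (0\<^sub>m k r  @\<^sub>c 0\<^sub>m k i' @\<^sub>c 0\<^sub>m k j  @\<^sub>c (\<epsilon> \<cdot>\<^sub>m D) @\<^sub>c 0\<^sub>m k e) @\<^sub>r
       (0\<^sub>m y r  @\<^sub>c 0\<^sub>m y i' @\<^sub>c 0\<^sub>m y j  @\<^sub>c 0\<^sub>m y k  @\<^sub>c 0\<^sub>m y e)) =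
    rect_diag (r + i' + j + k + y) (r + i' + j + k + e) (replicate (r + i') 1 @ cs @ map (Dual 0) ds)" (is "?L = ?R")
proof -
  have dims: "dim_row C = j" "dim_col C = j" "dim_row D = k" "dim_col D = k"
    using C D by (simp_all add: diag_of_list_def mat_diag_def)
  have zeros: "0\<^sub>m r i' @\<^sub>c 0\<^sub>m r j @\<^sub>c 0\<^sub>m r k @\<^sub>c 0\<^sub>m r e = (0\<^sub>m r (i' + (j + (k + e))) :: dual_quat mat)"
    "0\<^sub>m i' j @\<^sub>c 0\<^sub>m i' k @\<^sub>c 0\<^sub>m i' e = (0\<^sub>m i' (j + (k + e)) :: dual_quat mat)"
    "0\<^sub>m j k @\<^sub>c 0\<^sub>m j e = (0\<^sub>m j (k + e) :: dual_quat mat)"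
    by (simp_all add: zero_append_cols)
  have "?L = four_block_mat (1\<^sub>m r) (0\<^sub>m r (i' + (j + (k + e)))) (0\<^sub>m (i' + (j + (k + y))) r)
    (four_block_mat (1\<^sub>m i') (0\<^sub>m i' (j + (k + e))) (0\<^sub>m (j + (k + y)) i')
    (four_block_mat C (0\<^sub>m j (k + e)) (0\<^sub>m (k + y) j)
    (four_block_mat (\<epsilon> \<cdot>\<^sub>m D) (0\<^sub>m k e) (0\<^sub>m y k) (0\<^sub>m y e))))"
    unfolding zeros
    by (simp add: zero_col_append_rows append_rows_block_diag dims)
  also have "\<dots> = rect_diag (r + (i' + (j + (k + y)))) (r + (i' + (j + (k + e))))
      (replicate r 1 @ replicate i' 1 @ cs @ map (Dual 0) ds @ [])"
    unfolding C(1) D(1) diag_of_list_rect_diag one_mat_rect_diag zero_mat_rect_diag[of y e]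
    by (simp only: C(2) D(2) block_diag_rect_diag length_replicate length_map)
  also have "\<dots> = ?R"
    by (simp add: replicate_add add.assoc)
  finally show ?thesis .
qed

lemma Sigma_A_bottom:
  assumes \<Sigma>: "\<Sigma> = diag_of_list (map of_real \<sigma>s)" "length \<sigma>s = r"
    and S: "S = diag_of_list (map dq_of_dual ss)" "length ss = j"
  shows "(((\<epsilon> \<cdot>\<^sub>m \<Sigma>) @\<^sub>c 0\<^sub>m r i' @\<^sub>c 0\<^sub>m r j @\<^sub>c 0\<^sub>m r k  @\<^sub>c 0\<^sub>m r e) @\<^sub>r
       (0\<^sub>m z r  @\<^sub>c 0\<^sub>m z i' @\<^sub>c 0\<^sub>m z j  @\<^sub>c 0\<^sub>m z k  @\<^sub>c 0\<^sub>m z e) @\<^sub>r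
       (0\<^sub>m j r  @\<^sub>c 0\<^sub>m j i' @\<^sub>c S       @\<^sub>c 0\<^sub>m j k  @\<^sub>c 0\<^sub>m j e) @\<^sub>r
       (0\<^sub>m k r  @\<^sub>c 0\<^sub>m k i' @\<^sub>c 0\<^sub>m k j  @\<^sub>c 1\<^sub>m k    @\<^sub>c 0\<^sub>m k e) @\<^sub>r
       (0\<^sub>m e r  @\<^sub>c 0\<^sub>m e i' @\<^sub>c 0\<^sub>m e j  @\<^sub>c 0\<^sub>m e k  @\<^sub>c 1\<^sub>m e)) =
    four_block_mat (rect_diag (r + z) (r + i') (map (Dual 0) \<sigma>s)) (0\<^sub>m (r + z) (j + k + e))
      (0\<^sub>m (j + k + e) (r + i')) (rect_diag (j + k + e) (j + k + e) (ss @ replicate (k + e) 1))" (is "?L = ?R")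
proof -
  have dims: "dim_row S = j" "dim_col S = j" "dim_row \<Sigma> = r" "dim_col \<Sigma> = r"
    using S \<Sigma> by (simp_all add: diag_of_list_def mat_diag_def)
  have zeros: "0\<^sub>m r i' @\<^sub>c 0\<^sub>m r j @\<^sub>c 0\<^sub>m r k @\<^sub>c 0\<^sub>m r e = (0\<^sub>m r (i' + (j + (k + e))) :: dual_quat mat)"
    "0\<^sub>m z j @\<^sub>c 0\<^sub>m z k @\<^sub>c 0\<^sub>m z e = (0\<^sub>m z (j + (k + e)) :: dual_quat mat)"
    "0\<^sub>m j k @\<^sub>c 0\<^sub>m j e = (0\<^sub>m j (k + e) :: dual_quat mat)"
    by (simp_all add: zero_append_cols)
  have "?L = four_block_mat (\<epsilon> \<cdot>\<^sub>m \<Sigma>) (0\<^sub>m r (i' + (j + (k + e)))) (0\<^sub>m (z + (j + (k + e))) r)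
    (four_block_mat (0\<^sub>m z i') (0\<^sub>m z (j + (k + e))) (0\<^sub>m (j + (k + e)) i')
    (four_block_mat S (0\<^sub>m j (k + e)) (0\<^sub>m (k + e) j) (1\<^sub>m (k + e))))"
    unfolding zeros
    by (simp add: zero_col_append_rows append_rows_block_diag dims)
  also have "four_block_mat S (0\<^sub>m j (k + e)) (0\<^sub>m (k + e) j) (1\<^sub>m (k + e)) =
    rect_diag (j + (k + e)) (j + (k + e)) (ss @ replicate (k + e) 1)"
    unfolding S(1) diag_of_list_rect_diag one_mat_rect_diag
    by (simp only: S(2) block_diag_rect_diag)
  also have "four_block_mat (\<epsilon> \<cdot>\<^sub>m \<Sigma>) (0\<^sub>m r (i' + (j + (k + e))))
      (0\<^sub>m (z + (j + (k + e))) r)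
      (four_block_mat (0\<^sub>m z i') (0\<^sub>m z (j + (k + e))) (0\<^sub>m (j + (k + e)) i')
        (rect_diag (j + (k + e)) (j + (k + e)) (ss @ replicate (k + e) 1))) = ?R"
    unfolding \<Sigma>(1) diag_of_list_rect_diag \<Sigma>(2) add.assoc
    using \<Sigma>(2) by (intro block_diag_zero_block) auto
  finally show ?thesis .
qed

lemma append_rows_assoc:
  assumes "dim_col A = dim_col B" "dim_col B = dim_col C"
  shows "(A @\<^sub>r B) @\<^sub>r C = A @\<^sub>r B @\<^sub>r C"
  using assms by (intro eq_matI) (auto simp: append_rows_entry)

text \<open>The upper and the lower part of \<open>\<Sigma>\<^sub>A\<close> are the two matrices in the CS decomposition.\<close>

lemma Sigma_A_eq:
  assumes \<Sigma>: "\<Sigma> = diag_of_list (map of_real \<sigma>s)" "length \<sigma>s = r"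
    and D: "D = diag_of_list (map of_real ds)" "length ds = k"
    and C: "C = diag_of_list (map dq_of_dual cs)" "length cs = j"
    and S: "S = diag_of_list (map dq_of_dual ss)" "length ss = j"
    and le: "r \<le> i" "i + j + k \<le> p" "i + j + k \<le> q" "q \<le> m" "r + (p - i) \<le> m - q"
  shows "Sigma_A m p q r i j k \<Sigma> D C S =
    rect_diag q p (replicate i 1 @ cs @ map (Dual 0) ds) @\<^sub>r
    four_block_mat (rect_diag (m - q - (p - i)) i (map (Dual 0) \<sigma>s)) (0\<^sub>m (m - q - (p - i)) (p - i))
        (0\<^sub>m (p - i) i) (rect_diag (p - i) (p - i) (ss @ replicate (p - i - j) 1))"
proof -
  obtain i' where i: "i = r + i'" using le by (auto dest: le_Suc_ex)
  obtain e where p: "p = r + i' + j + k + e" using le i by (auto dest: le_Suc_ex)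
  obtain y where q: "q = r + i' + j + k + y" using le i by (auto dest: le_Suc_ex)
  have "r + (j + k + e) \<le> m - q" using le p i by simp
  then obtain z where "m - q = r + (j + k + e) + z" by (auto dest: le_Suc_ex)
  then have m: "m = q + r + (j + k + e) + z" using le by simp
  have dims: "dim_row C = j" "dim_col C = j" "dim_row D = k" "dim_col D = k"
    "dim_row S = j" "dim_col S = j" "dim_row \<Sigma> = r" "dim_col \<Sigma> = r"
    using C D S \<Sigma> by (simp_all add: diag_of_list_def mat_diag_def)
  have sub: "i - r = i'" "p - i = j + k + e" "j + k + e - j = k + e" "k + e - k = e"
    "q - i = j + k + y" "j + k + y - j = k + y" "k + y - k = y"
    "m - q = r + z + (j + k + e)" "r + z + (j + k + e) - r = z + (j + k + e)"
    "z + (j + k + e) - (j + k + e) = z" "r + z + (j + k + e) - (j + k + e) = r + z"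
    using m by (simp_all add: i p q)
  show ?thesis
    unfolding Sigma_A_def Let_def sub
    unfolding p q
    unfolding i Sigma_A_top[OF C D, symmetric] Sigma_A_bottom[OF \<Sigma> S, symmetric]
    by (simp add: append_rows_assoc dims)
qed

lemma Sigma_B_mult:
  assumes "q \<le> m" "X \<in> carrier_mat m q" "Y \<in> carrier_mat m (m - q)"
  shows "(X @\<^sub>c Y) * Sigma_B m q = X"
proof -
  have "(X @\<^sub>c Y) * Sigma_B m q = X * 1\<^sub>m q + Y * 0\<^sub>m (m - q) q"
    unfolding Sigma_B_def using assms by (intro append_cols_mult_append_rows) auto
  then show ?thesis using assms by auto
qed

lemma block_diag_mult_append_rows:
  fixes A :: "'a :: semiring_0 mat"
  assumes "A \<in> carrier_mat a c" "D \<in> carrier_mat b d" "X \<in> carrier_mat c n" "Y \<in> carrier_mat d n"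
  shows "four_block_mat A (0\<^sub>m a d) (0\<^sub>m b c) D * (X @\<^sub>r Y) = A * X @\<^sub>r D * Y"
  using assms by (intro eq_matI)
    (auto simp: append_rows_entry mat_entry_mult sum_split_nat simp del: index_mult_mat(1))

lemma factor_with_zero_cols:
  fixes G :: "'a :: ring_1 mat"
  assumes "G \<in> carrier_mat m p" "V \<in> carrier_mat p p" "R \<in> carrier_mat p n" "p \<le> n"
  shows "(G @\<^sub>c 0\<^sub>m m (n - p)) * (four_block_mat V (0\<^sub>m p (n - p)) (0\<^sub>m (n - p) p) (1\<^sub>m (n - p)) *
    (R @\<^sub>r 0\<^sub>m (n - p) n)) = G * (V * R)"
proof -
  have "four_block_mat V (0\<^sub>m p (n - p)) (0\<^sub>m (n - p) p) (1\<^sub>m (n - p)) * (R @\<^sub>r 0\<^sub>m (n - p) n) =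
    V * R @\<^sub>r 1\<^sub>m (n - p) * 0\<^sub>m (n - p) n"
    using assms by (intro block_diag_mult_append_rows) auto
  moreover have "(G @\<^sub>c 0\<^sub>m m (n - p)) * (V * R @\<^sub>r 1\<^sub>m (n - p) * 0\<^sub>m (n - p) n) =
    G * (V * R) + 0\<^sub>m m (n - p) * (1\<^sub>m (n - p) * 0\<^sub>m (n - p) n)"
    using assms by (intro append_cols_mult_append_rows) auto
  moreover have "0\<^sub>m m (n - p) * (1\<^sub>m (n - p) * 0\<^sub>m (n - p) n) = (0\<^sub>m m n :: 'a mat)"
    by (simp add: left_mult_zero_mat[of _ "n - p" n])
  moreover have "G * (V * R) \<in> carrier_mat m n" using assms by auto
  ultimately show ?thesis by (simp only: right_add_zero_mat)
qed

theorem theorem4p4: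
  fixes A B :: "dual_quat mat" and m n l p q :: nat
  assumes "A \<in> carrier_mat m n" and "B \<in> carrier_mat m l"
    and "dq_rank A = p" and "dq_rank B = q"
  shows "\<exists>(Q :: dual_quat mat) XA XB
      (r :: nat) (i :: nat) (j :: nat) (k :: nat)
      (\<sigma>s :: real list) (ds :: real list) (cs :: dual_number list) (ss :: dual_number list)
      \<Sigma> D C S
      QA R1 R1h QB QBh R2 R2h U1 U2 V1.
    unitary_mat m Q \<and> XA \<in> carrier_mat n n \<and> XB \<in> carrier_mat l l \<and>
    A = Q * (Sigma_A m p q r i j k \<Sigma> D C S @\<^sub>c 0\<^sub>m m (n - p)) * XA \<and>
    B = Q * (Sigma_B m q @\<^sub>c 0\<^sub>m m (l - q)) * XB \<and>
    p \<le> n \<and> q \<le> l \<and> q \<le> m \<and>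
    r \<le> i \<and> i + j + k \<le> p \<and> i + j + k \<le> q \<and> r + (p - i) \<le> m - q \<and>
    \<Sigma> = diag_of_list (map of_real \<sigma>s) \<and> length \<sigma>s = r \<and>
    sorted_wrt (\<ge>) \<sigma>s \<and> (\<forall>\<sigma> \<in> set \<sigma>s. \<sigma> > 0) \<and>
    D = diag_of_list (map of_real ds) \<and> length ds = k \<and> (\<forall>d \<in> set ds. d > 0) \<and>
    C = diag_of_list (map dq_of_dual cs) \<and> length cs = j \<and>
    sorted_wrt (\<ge>) cs \<and> (\<forall>c \<in> set cs. appreciable c \<and> 0 < c \<and> c < 1) \<and>
    S = diag_of_list (map dq_of_dual ss) \<and> length ss = j \<and>
    sorted_wrt (\<le>) ss \<and> (\<forall>s \<in> set ss. appreciable s \<and> 0 < s \<and> s < 1) \<and>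
    C * C + S * S = 1\<^sub>m j \<and>
    Q = (QB @\<^sub>c QBh) * four_block_mat U1 (0\<^sub>m q (m - q)) (0\<^sub>m (m - q) q) U2 \<and>
    XA = four_block_mat (conj_transpose V1) (0\<^sub>m p (n - p)) (0\<^sub>m (n - p) p) (1\<^sub>m (n - p))
           * (R1 @\<^sub>r R1h) \<and>
    XB = four_block_mat (conj_transpose U1) (0\<^sub>m q (l - q)) (0\<^sub>m (l - q) q) (1\<^sub>m (l - q))
           * (R2 @\<^sub>r R2h) \<and>
    unitary_decomposition A QA R1 \<and> unitary_decomposition B QB R2 \<and>
    QA \<in> carrier_mat m p \<and> R1 \<in> carrier_mat p n \<and>
    QB \<in> carrier_mat m q \<and> R2 \<in> carrier_mat q l \<and>
    R1h \<in> carrier_mat (n - p) n \<and> R2h \<in> carrier_mat (l - q) l \<and>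
    QBh \<in> carrier_mat m (m - q) \<and> unitary_mat m (QB @\<^sub>c QBh) \<and>
    unitary_mat q U1 \<and> unitary_mat (m - q) U2 \<and> unitary_mat p V1"
proof -
  obtain QA QA' R1 where decA: "unitary_decomposition A QA R1" and p: "p \<le> m" "p \<le> n"
    and QA: "QA \<in> carrier_mat m p" and R1: "R1 \<in> carrier_mat p n" and AQR: "A = QA * R1"
    and QAQA: "conj_transpose QA * QA = 1\<^sub>m p"
    using unitary_decomposition_exists[OF assms(1,3)] by metis
  obtain QB QBh R2 where decB: "unitary_decomposition B QB R2" and q: "q \<le> m" "q \<le> l"
    and QB: "QB \<in> carrier_mat m q" and R2: "R2 \<in> carrier_mat q l" and QBh: "QBh \<in> carrier_mat m (m - q)"
    and BQR: "B = QB * R2" and G: "unitary_mat m (QB @\<^sub>c QBh)"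
    using unitary_decomposition_exists[OF assms(2,4)] by metis
  let ?G = "QB @\<^sub>c QBh"
  note Gc = unitary_matD(1-3)[OF G]
  define W1 where "W1 = conj_transpose QB * QA"
  define W2 where "W2 = conj_transpose QBh * QA"
  have W1: "W1 \<in> carrier_mat q p" and W2: "W2 \<in> carrier_mat (m - q) p"
    using QA QB QBh by (auto simp: W1_def W2_def)
  have GQ: "conj_transpose ?G * QA = W1 @\<^sub>r W2"
    unfolding W1_def W2_def using QA QB QBh by (simp add: conj_transpose_append_cols append_rows_mult)
  have "conj_transpose W1 * W1 + conj_transpose W2 * W2 =
      (conj_transpose W1 @\<^sub>c conj_transpose W2) * (W1 @\<^sub>r W2)"
    using W1 W2 by (intro append_cols_mult_append_rows[symmetric]) auto
  also have "conj_transpose W1 @\<^sub>c conj_transpose W2 = conj_transpose (W1 @\<^sub>r W2)"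
    using W1 W2 by (intro eq_matI) (auto simp: append_rows_entry append_cols_entry)
  also have "\<dots> * (W1 @\<^sub>r W2) = conj_transpose QA * QA"
    unfolding GQ[symmetric] using Gc QA by (simp add: conj_transpose_mult mat_mult_assoc unitary_cancel[OF G])
  finally have sum: "conj_transpose W1 * W1 + conj_transpose W2 * W2 = 1\<^sub>m p"
    using QAQA by simp
  obtain U1 U2 V1 i \<sigma>s ds cs
    where U1: "unitary_mat q U1" and U2: "unitary_mat (m - q) U2" and V1: "unitary_mat p V1"
      and le: "i + length cs + length ds \<le> p" "i + length cs + length ds \<le> q"
        "length \<sigma>s \<le> i" "length \<sigma>s + (p - i) \<le> m - q"
      and \<sigma>s: "sorted_wrt (\<ge>) \<sigma>s" "\<forall>\<sigma>\<in>set \<sigma>s. \<sigma> > 0" and ds: "\<forall>d\<in>set ds. d > 0"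
      and cs: "sorted_wrt (\<ge>) cs" "\<forall>c\<in>set cs. 0 < std_part c \<and> std_part c < 1"
      and top: "conj_transpose U1 * W1 * V1 = rect_diag q p (replicate i 1 @ cs @ map (Dual 0) ds)"
      and bottom: "conj_transpose U2 * W2 * V1 =
        four_block_mat (rect_diag (m - q - (p - i)) i (map (Dual 0) \<sigma>s)) (0\<^sub>m (m - q - (p - i)) (p - i))
          (0\<^sub>m (p - i) i) (rect_diag (p - i) (p - i)
            (map dual_cosine_to_sine cs @ replicate (p - i - length cs) 1))"
    using dual_quat_cs_decomposition[OF W1 W2 sum] by metis
  note U1c = unitary_matD(1-3)[OF U1] and U2c = unitary_matD(1-3)[OF U2] and V1c = unitary_matD(1-3)[OF V1]
  define ss where "ss = map dual_cosine_to_sine cs"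
  define \<Sigma> D C S where "\<Sigma> = (diag_of_list (map of_real \<sigma>s) :: dual_quat mat)"
    and "D = (diag_of_list (map of_real ds) :: dual_quat mat)"
    and "C = diag_of_list (map dq_of_dual cs)" and "S = diag_of_list (map dq_of_dual ss)"
  let ?\<Sigma>A = "Sigma_A m p q (length \<sigma>s) i (length cs) (length ds) \<Sigma> D C S"
  have \<Sigma>A: "?\<Sigma>A = conj_transpose U1 * W1 * V1 @\<^sub>r conj_transpose U2 * W2 * V1"
    unfolding top bottom ss_def[symmetric]
    by (rule Sigma_A_eq[OF \<Sigma>_def refl D_def refl C_def refl S_def _ le(3,1,2) q(1) le(4)])
      (simp add: ss_def)
  have "conj_transpose U1 * W1 * V1 \<in> carrier_mat q p" "conj_transpose U2 * W2 * V1 \<in> carrier_mat (m - q) p"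
    using U1c U2c V1c W1 W2 by auto
  from carrier_append_rows[OF this] have \<Sigma>Ac: "?\<Sigma>A \<in> carrier_mat m p"
    unfolding \<Sigma>A using q by simp
  let ?BU = "four_block_mat U1 (0\<^sub>m q (m - q)) (0\<^sub>m (m - q) q) U2"
  let ?Q = "?G * ?BU"
  have BU: "unitary_mat m ?BU" using unitary_block_diag[OF U1 U2] q by simp
  have Q: "unitary_mat m ?Q" by (rule unitary_mult[OF G BU])
  note Qc = unitary_matD(1-3)[OF Q] and BUc = unitary_matD(1-3)[OF BU]
  have Q\<Sigma>A: "?Q * ?\<Sigma>A = QA * V1"
  proof -
    have "?BU * ?\<Sigma>A = U1 * (conj_transpose U1 * W1 * V1) @\<^sub>r U2 * (conj_transpose U2 * W2 * V1)"
      unfolding \<Sigma>A using U1c U2c V1c W1 W2 by (intro block_diag_mult_append_rows) auto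
    also have "\<dots> = W1 * V1 @\<^sub>r W2 * V1"
      using U1c U2c V1c W1 W2 by (simp add: mat_mult_assoc unitary_cancel[OF U1] unitary_cancel[OF U2])
    also have "\<dots> = conj_transpose ?G * QA * V1"
      unfolding GQ using V1c W1 W2 by (simp add: append_rows_mult)
    finally have "?BU * ?\<Sigma>A = conj_transpose ?G * QA * V1" .
    then show ?thesis
      using Gc BUc \<Sigma>Ac QA V1c by (simp add: mat_mult_assoc unitary_cancel[OF G] del: dim_append_cols)
  qed
  have Q_cols: "?Q = QB * U1 @\<^sub>c QBh * U2"
    using QB QBh U1c U2c by (intro append_cols_mult_block_diag) auto
  have Q\<Sigma>B: "?Q * Sigma_B m q = QB * U1"
    unfolding Q_cols using q QB QBh U1c U2c by (intro Sigma_B_mult) auto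
  have \<Sigma>Bc: "Sigma_B m q \<in> carrier_mat m q"
    using q carrier_append_rows[of "1\<^sub>m q" q q "0\<^sub>m (m - q) q" "m - q"] by (simp add: Sigma_B_def)
  \<comment> \<open>The lower blocks of the right factors meet only zero columns, so they may be \<open>0\<close>.\<close>
  let ?XA = "four_block_mat (conj_transpose V1) (0\<^sub>m p (n - p)) (0\<^sub>m (n - p) p) (1\<^sub>m (n - p))
           * (R1 @\<^sub>r 0\<^sub>m (n - p) n)"
  let ?XB = "four_block_mat (conj_transpose U1) (0\<^sub>m q (l - q)) (0\<^sub>m (l - q) q) (1\<^sub>m (l - q))
           * (R2 @\<^sub>r 0\<^sub>m (l - q) l)"
  have XA: "?XA \<in> carrier_mat n n" and XB: "?XB \<in> carrier_mat l l"
    using V1c U1c R1 R2 p q by (auto intro!: carrier_matI)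
  have A_eq: "A = ?Q * (?\<Sigma>A @\<^sub>c 0\<^sub>m m (n - p)) * ?XA"
  proof -
    have "?Q * (?\<Sigma>A @\<^sub>c 0\<^sub>m m (n - p)) * ?XA = ?Q * ((?\<Sigma>A @\<^sub>c 0\<^sub>m m (n - p)) * ?XA)"
      using Qc \<Sigma>Ac V1c p R1 by (intro mat_mult_assoc) auto
    also have "\<dots> = ?Q * (?\<Sigma>A * (conj_transpose V1 * R1))"
      using \<Sigma>Ac V1c R1 p by (subst factor_with_zero_cols) auto
    also have "\<dots> = ?Q * ?\<Sigma>A * (conj_transpose V1 * R1)"
      using Qc \<Sigma>Ac V1c R1 by (intro mat_mult_assoc[symmetric]) auto
    also have "\<dots> = A"
      unfolding Q\<Sigma>A AQR using QA V1c R1 by (simp add: mat_mult_assoc unitary_cancel[OF V1])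
    finally show ?thesis by simp
  qed
  have B_eq: "B = ?Q * (Sigma_B m q @\<^sub>c 0\<^sub>m m (l - q)) * ?XB"
  proof -
    have "?Q * (Sigma_B m q @\<^sub>c 0\<^sub>m m (l - q)) * ?XB = ?Q * ((Sigma_B m q @\<^sub>c 0\<^sub>m m (l - q)) * ?XB)"
      using Qc \<Sigma>Bc U1c q R2 by (intro mat_mult_assoc) auto
    also have "\<dots> = ?Q * (Sigma_B m q * (conj_transpose U1 * R2))"
      using \<Sigma>Bc U1c R2 q by (subst factor_with_zero_cols) auto
    also have "\<dots> = ?Q * Sigma_B m q * (conj_transpose U1 * R2)"
      using Qc \<Sigma>Bc U1c R2 by (intro mat_mult_assoc[symmetric]) auto
    also have "\<dots> = B"
      unfolding Q\<Sigma>B BQR using QB U1c R2 by (simp add: mat_mult_assoc unitary_cancel[OF U1])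
    finally show ?thesis by simp
  qed
  have cs': "\<forall>c\<in>set cs. appreciable c \<and> 0 < c \<and> c < 1"
    using cs(2) by (auto simp: appreciable_def less_dual_def)
  have ss: "\<forall>s\<in>set ss. appreciable s \<and> 0 < s \<and> s < 1"
    using cs(2) sine_bounds by (auto simp: ss_def)
  have "sorted_wrt (\<lambda>c c'. dual_cosine_to_sine c \<le> dual_cosine_to_sine c') cs"
    by (rule sorted_wrt_mono_rel[OF _ cs(1)]) (use cs(2) sine_antimono in auto)
  then have ss_sorted: "sorted_wrt (\<le>) ss"
    by (simp add: ss_def sorted_wrt_map)
  have CS: "C * C + S * S = 1\<^sub>m (length cs)"
  proof -
    have "dq_of_dual (cs ! a) * dq_of_dual (cs ! a) + dq_of_dual (ss ! a) * dq_of_dual (ss ! a) = 1"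
      if "a < length cs" for a
    proof -
      have "cs ! a \<in> set cs" using that by simp
      then have "std_part (cs ! a) < 1" "0 \<le> std_part (cs ! a)"
        using cs(2) less_imp_le by blast+
      from sine_square[OF this] have "cs ! a * cs ! a + ss ! a * ss ! a = 1"
        using that by (simp add: ss_def)
      then show ?thesis by (simp flip: dq_of_dual_mult dq_of_dual_add)
    qed
    moreover have "C = mat_diag (length cs) (\<lambda>a. dq_of_dual (cs ! a))"
      "S = mat_diag (length cs) (\<lambda>a. dq_of_dual (ss ! a))"
      unfolding C_def S_def diag_of_list_def mat_diag_def by (auto intro!: eq_matI simp: ss_def)
    ultimately show ?thesis
      by (intro eq_matI) (simp_all only: mat_diag_diag, auto simp: mat_diag_def)
  qed
  show ?thesis
    by (rule exI[of _ ?Q], rule exI[of _ ?XA], rule exI[of _ ?XB], rule exI[of _ "length \<sigma>s"],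
      rule exI[of _ i], rule exI[of _ "length cs"], rule exI[of _ "length ds"], rule exI[of _ \<sigma>s],
      rule exI[of _ ds], rule exI[of _ cs], rule exI[of _ ss], rule exI[of _ \<Sigma>], rule exI[of _ D],
      rule exI[of _ C], rule exI[of _ S], rule exI[of _ QA], rule exI[of _ R1],
      rule exI[of _ "0\<^sub>m (n - p) n"], rule exI[of _ QB], rule exI[of _ QBh], rule exI[of _ R2],
      rule exI[of _ "0\<^sub>m (l - q) l"], rule exI[of _ U1], rule exI[of _ U2], rule exI[of _ V1],
      intro conjI; (fact | rule refl | rule zero_carrier_mat | simp add: ss_def))
qed

end
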